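(* Let $(Z_i)_{i\ge 1}$ be an independent equidistributed process on a finite alphabet $\mathcal{A}$ (i.e. the $Z_i$ are independent and uniformly distributed on $\mathcal{A}$), with entropy $H$. For each block length $\ell$ let $k(\ell)$ be the number of blocks and let $S_1,\dots,S_{k(\ell)}$ be the non-overlapping return times of the first $k(\ell)$ blocks of length $\ell$. If, as $\ell \to \infty$, $k(\ell) \to \infty$ in such a way that $k(\ell)\, \ell\, |\mathcal{A}|^{-\ell} \to 0$, then $$ \frac{\sum_{i=1}^{k(\ell)} (\log S_i - \ell H \log 2 + \gamma)}{\sqrt{k(\ell)\, \pi^2/6}} \longrightarrow N(0,1) \quad \text{in distribution as } \ell\to\infty.$$
   Context: Here $\log$ is the natural logarithm, $\gamma = 0.577216\ldots$ is Euler's constant, and the entropy is computed to base 2, so $H = \log_2|\mathcal{A}|$. Blocks: for block length $\ell$, set $X_i = (Z_{(i-1)\ell+1}, \ldots, Z_{i\ell}) \in \mathcal{A}^\ell$ for $i\ge 1$. Non-overlapping return time: $S_j = \min\{t\ge 1 : X_{j+t} = X_j\}$ for $j=1,\dots,k$. (The $X_i$ and $S_j$ depend on $\ell$.) *)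

theory Defs
  imports "HOL-Probability.Probability"
begin

text \<open>Processes are indexed by \<open>i \<ge> 1\<close>; the value of \<open>Z 0\<close> is never used.
  The \<open>i\<close>-th non-overlapping block (\<open>i \<ge> 1\<close>) of length \<open>l\<close> is
  \<open>(Z_{(i-1)l+1}, ..., Z_{il})\<close>, represented as a list of length \<open>l\<close>.\<close>

definition block :: "(nat \<Rightarrow> 'w \<Rightarrow> 'a) \<Rightarrow> nat \<Rightarrow> nat \<Rightarrow> 'w \<Rightarrow> 'a list" where
  "block Z l i w = map (\<lambda>m. Z m w) [(i - 1) * l + 1..<i * l + 1]"

text \<open>Outcomes for which block \<open>j\<close> never recurs form a null set for the processes considered
  here. On them \<open>return_time\<close> is the constant \<open>Inf {}\<close>, so \<open>return_time Z l j\<close>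
  remains a measurable function.\<close>

definition return_time :: "(nat \<Rightarrow> 'w \<Rightarrow> 'a) \<Rightarrow> nat \<Rightarrow> nat \<Rightarrow> 'w \<Rightarrow> nat" where
  "return_time Z l j w = Inf {t. 1 \<le> t \<and> block Z l (j + t) w = block Z l j w}"

definition iid_uniform_process :: "'w measure \<Rightarrow> 'a set \<Rightarrow> (nat \<Rightarrow> 'w \<Rightarrow> 'a) \<Rightarrow> bool" where
  "iid_uniform_process M A Z \<longleftrightarrow>
     prob_space.indep_vars M (\<lambda>_. count_space A) Z {1..} \<and>
     (\<forall>i\<ge>1. distr M (count_space A) (Z i) = uniform_count_measure A)"

text \<open>Entropy of a finite-alphabet process, in bits per symbol: the limit of
  \<open>H(Z_1, ..., Z_n) / n\<close>, where \<open>(Z_1, ..., Z_n)\<close> is the first block of length \<open>n\<close>. For an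
  independent process that is uniform on \<open>A\<close> it equals \<open>log 2 (card A)\<close>.\<close>

definition process_entropy :: "'w measure \<Rightarrow> (nat \<Rightarrow> 'w \<Rightarrow> 'a) \<Rightarrow> real" where
  "process_entropy M Z =
     lim (\<lambda>n. prob_space.entropy M 2 (count_space (block Z n 1 ` space M)) (block Z n 1) / real n)"

end

theory Submission
  imports Defs
begin

text \<open>Write \<open>N = |A|^l\<close>. The blocks form an i.i.d. uniform sequence on \<open>N\<close> symbols, and given the
  blocks after the \<open>j\<close>-th one, \<open>S_j\<close> is the first occurrence time \<open>T_b\<close> of a uniformly chosen symbol
  \<open>b\<close>. So if \<open>f\<close> is the exponential \<open>f(t) = exp(iu(log t - log N + \<gamma>))\<close> with \<open>u\<close> of order \<open>k^(-1/2)\<close>,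
  peeling off \<open>S_1, S_2, ...\<close> in turn replaces \<open>E[f(S_1) ... f(S_k)]\<close> by \<open>c^k\<close>, \<open>c = E f(S_1)\<close>, at cost
  \<open>k E|g - c|\<close>, where \<open>g = N^(-1) \<Sum>_b f(T_b)\<close>. The times \<open>T_a\<close>, \<open>T_b\<close> are nearly uncorrelated, which
  gives \<open>Var g = O(u^2/N)\<close>, so this cost is \<open>O(sqrt(k/N))\<close>. Since the geometric variable \<open>S_1\<close> is the
  ceiling of a scaled exponential one, \<open>c\<close> differs from \<open>exp(iu\<gamma>) \<Gamma>(1+iu)\<close> by \<open>O(u/sqrt N)\<close>, and
  the \<open>k\<close>-th power of the latter converges to the Gaussian characteristic function because
  \<open>log \<Gamma>(1+z) = -\<gamma>z + \<pi>^2 z^2/12 + O(z^3)\<close>. Levy's continuity theorem concludes.\<close>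

subsection \<open>The Gamma function near 1\<close>

lemma norm_cis_diff_le: "norm (cis a - cis b) \<le> \<bar>a - b\<bar>"
proof -
  have "cis a - cis b = cis b * (iexp (a - b) - 1)"
    by (simp add: cis_conv_exp exp_diff right_diff_distrib of_real_diff)
  also have "norm \<dots> = norm (iexp (a - b) - 1)" by (simp add: norm_mult)
  also have "\<dots> \<le> \<bar>a - b\<bar>" using iexp_approx1[of "a - b" 0] by simp
  finally show ?thesis .
qed

lemma Polygamma_1_1: "Polygamma 1 (1::complex) = of_real (pi\<^sup>2 / 6)"
proof -
  have "(\<lambda>n. of_real (1 / (real (n + 1))\<^sup>2) :: complex) sums of_real (pi\<^sup>2 / 6)"
    using inverse_squares_sums unfolding sums_of_real_iff by (simp add: add_ac)
  thus ?thesis by (simp add: Polygamma_def sums_iff inverse_eq_divide power2_eq_square add_ac)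
qed

text \<open>Taylor expansion at 1: the first two derivatives of \<open>ln_Gamma\<close> there are
  \<open>- euler_mascheroni\<close> and \<open>pi^2 / 6\<close>. The third,
  \<open>Polygamma 2\<close>, is bounded for \<open>norm z \<le> 1/2\<close>, where
  \<open>1 + z\<close> stays away from the poles and the branch cut.\<close>

lemma ln_Gamma_1_plus_Taylor2:
  obtains C where "C \<ge> 0" "\<And>z::complex. norm z \<le> 1/2 \<Longrightarrow>
     norm (ln_Gamma (1 + z) + euler_mascheroni * z - of_real (pi\<^sup>2 / 12) * z\<^sup>2) \<le> C * norm z ^ 3"
proof -
  let ?S = "cball (0::complex) (1/2)"
  \<comment> \<open>Successive derivatives of the function to be expanded. The summand
    \<open>euler_mascheroni\<close> cancels \<open>Digamma 1\<close>, so only the term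
    \<open>i = 2\<close> survives at 0.\<close>
  define f :: "nat \<Rightarrow> complex \<Rightarrow> complex" where
    "f = (\<lambda>i z. if i = 0 then ln_Gamma (1 + z) + euler_mascheroni * z
               else Polygamma (i - 1) (1 + z) + (if i = 1 then euler_mascheroni else 0))"
  have Re: "Re (1 + z) > 0" if "z \<in> ?S" for z
    using that abs_Re_le_cmod[of z] by auto
  have nonpos: "1 + z \<notin> \<real>\<^sub>\<le>\<^sub>0" "1 + z \<notin> \<int>\<^sub>\<le>\<^sub>0" if "z \<in> ?S" for z
    using Re[OF that] using nonpos_Ints_subset_nonpos_Reals by (auto simp: complex_nonpos_Reals_iff)
  have "compact ((\<lambda>z. Polygamma 2 (1 + z)) ` ?S)"
    using nonpos by (intro compact_continuous_image continuous_at_imp_continuous_on ballI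
      isCont_Polygamma continuous_intros) auto
  then obtain C where C: "\<And>z. z \<in> ?S \<Longrightarrow> norm (Polygamma 2 (1 + z)) \<le> C"
    using compact_imp_bounded bounded_iff by (metis (no_types, lifting) imageI)
  have "C \<ge> 0" using order.trans[OF norm_ge_zero C[of 0]] by simp
  moreover have "norm (ln_Gamma (1 + z) + euler_mascheroni * z - of_real (pi\<^sup>2 / 12) * z\<^sup>2) \<le> C * norm z ^ 3"
    if "norm z \<le> 1/2" for z :: complex
  proof -
    have "norm (f 0 z - (\<Sum>i\<le>2. f i 0 * (z - 0) ^ i / fact i)) \<le> C * norm (z - 0) ^ Suc 2 / fact 2"
    proof (rule complex_Taylor)
      fix i x assume x: "x \<in> ?S" and "i \<le> (2::nat)"
      then consider "i = 0" | "i = 1" | "i = 2" by linarith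
      thus "(f i has_field_derivative f (Suc i) x) (at x within ?S)"
        by cases (auto simp: f_def numeral_2_eq_2 intro!: derivative_eq_intros nonpos x)
    qed (use C that in \<open>auto simp: f_def\<close>)
    also have "(\<Sum>i\<le>2. f i 0 * (z - 0) ^ i / fact i) = of_real (pi\<^sup>2 / 12) * z\<^sup>2"
      by (simp add: f_def numeral_2_eq_2 Polygamma_1_1[unfolded One_nat_def]
          ln_Gamma_complex_conv_fact[of 1, simplified])
    also have "C * norm (z - 0) ^ Suc 2 / fact 2 \<le> C * norm z ^ 3"
      using \<open>C \<ge> 0\<close> by (simp add: numeral_3_eq_3 numeral_2_eq_2)
    finally show ?thesis by (simp add: f_def)
  qed
  ultimately show ?thesis by (rule that)
qed

text \<open>The base is the characteristic function of \<open>ln X + \<gamma>\<close> for a standard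
  exponential \<open>X\<close>, a variable of mean 0 and variance \<open>pi^2 / 6\<close>. Since
  \<open>k u^2\<close> is constant, \<open>k\<close> times its logarithm is
  \<open>- \<theta>^2 / 2 + O(u)\<close>, and \<open>u\<close> tends to 0.\<close>

lemma Gamma_power_tendsto_gaussian:
  fixes k :: "nat \<Rightarrow> nat" and \<theta> :: real
  assumes k: "filterlim k at_top sequentially"
  defines "u \<equiv> \<lambda>n. \<theta> / sqrt (real (k n) * pi\<^sup>2 / 6)"
  shows "(\<lambda>n. (cis (u n * euler_mascheroni) * Gamma (1 + \<i> * u n)) ^ k n)
           \<longlonglongrightarrow> complex_of_real (exp (- (\<theta>\<^sup>2) / 2))"
proof -
  obtain C where C: "C \<ge> 0" "\<And>z::complex. norm z \<le> 1/2 \<Longrightarrow>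
     norm (ln_Gamma (1 + z) + euler_mascheroni * z - of_real (pi\<^sup>2 / 12) * z\<^sup>2) \<le> C * norm z ^ 3"
    using ln_Gamma_1_plus_Taylor2 by blast
  define g where "g n = ln_Gamma (1 + \<i> * u n) + euler_mascheroni * (\<i> * u n)" for n
  have k': "filterlim (\<lambda>n. real (k n)) at_top sequentially"
    using k filterlim_real_sequentially filterlim_compose by blast
  have "filterlim (\<lambda>n. sqrt (real (k n) * (pi\<^sup>2 / 6))) at_top sequentially"
    by (intro filterlim_compose[OF sqrt_at_top] filterlim_at_top_mult_tendsto_pos[OF tendsto_const _ k'])
       (simp add: pi_gt_zero)
  hence u: "u \<longlonglongrightarrow> 0"
    unfolding u_def times_divide_eq_right by (rule real_tendsto_divide_at_top[OF tendsto_const])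
  have u_sq: "real (k n) * (u n)\<^sup>2 = 6 * \<theta>\<^sup>2 / pi\<^sup>2" if "k n > 0" for n
    using that by (simp add: u_def power_divide field_simps)
  have bound: "\<forall>\<^sub>F n in sequentially. norm (real (k n) * g n - (- (\<theta>\<^sup>2) / 2))
       \<le> C * (6 * \<theta>\<^sup>2 / pi\<^sup>2) * \<bar>u n\<bar>"
  proof -
    have "\<forall>\<^sub>F n in sequentially. \<bar>u n\<bar> < 1/2"
      using order_tendstoD(2)[OF tendsto_rabs[OF u], of "1/2"] by simp
    moreover have "\<forall>\<^sub>F n in sequentially. k n > 0"
      using k[unfolded filterlim_at_top, rule_format, of 1] by (auto elim!: eventually_mono)
    ultimately show ?thesis
    proof eventually_elim
      case (elim n)
      have sq: "of_real (pi\<^sup>2 / 12) * (\<i> * u n)\<^sup>2 * real (k n) = complex_of_real (- (\<theta>\<^sup>2) / 2)"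
        using arg_cong[OF u_sq[OF elim(2)], of "\<lambda>x. complex_of_real (- (pi\<^sup>2 / 12) * x)"] 
        by (simp add: power_mult_distrib mult_ac field_simps)
      have "real (k n) * g n - (- (\<theta>\<^sup>2) / 2)
          = real (k n) * (g n - of_real (pi\<^sup>2 / 12) * (\<i> * u n)\<^sup>2)"
        using sq by (simp add: right_diff_distrib mult_ac)
      also have "norm \<dots> \<le> real (k n) * (C * norm (\<i> * u n) ^ 3)"
        unfolding norm_mult[of "complex_of_real (real (k n))"] g_def 
        using elim(1) by (intro mult_mono C(2)) (auto simp: norm_mult)
      also have "\<dots> = C * (real (k n) * (u n)\<^sup>2) * \<bar>u n\<bar>"
        by (simp add: norm_mult power3_eq_cube power2_eq_square)
      finally show ?case unfolding u_sq[OF elim(2)] by simp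
    qed
  qed
  have "(\<lambda>n. real (k n) * g n - (- (\<theta>\<^sup>2) / 2)) \<longlonglongrightarrow> 0"
    using bound by (rule Lim_null_comparison)
      (rule tendsto_eq_rhs, rule tendsto_mult[OF tendsto_const tendsto_rabs[OF u]], simp)
  hence "(\<lambda>n. real (k n) * g n) \<longlonglongrightarrow> complex_of_real (- (\<theta>\<^sup>2) / 2)"
    by (rule LIM_zero_cancel)
  hence "(\<lambda>n. exp (real (k n) * g n)) \<longlonglongrightarrow> complex_of_real (exp (- (\<theta>\<^sup>2) / 2))"
    unfolding exp_of_real[symmetric] by (rule tendsto_exp)
  \<comment> \<open>Only the exponential of \<open>g n\<close> enters, so no logarithm of the base
    itself has to be selected.\<close>
  moreover have "exp (real (k n) * g n) = (cis (u n * euler_mascheroni) * Gamma (1 + \<i> * u n)) ^ k n" for n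
  proof -
    have "Gamma (1 + \<i> * u n) = exp (ln_Gamma (1 + \<i> * u n))"
      by (subst Gamma_complex_altdef) (auto elim!: nonpos_Ints_cases simp: complex_eq_iff)
    hence "exp (g n) = cis (u n * euler_mascheroni) * Gamma (1 + \<i> * u n)"
      by (simp add: g_def exp_add cis_conv_exp mult_ac of_real_euler_mascheroni)
    thus ?thesis by (simp add: exp_of_nat_mult)
  qed
  ultimately show ?thesis by simp
qed

subsection \<open>Geometric and exponential laws\<close>

text \<open>Since \<open>cis (u * ln x)\<close> is \<open>x\<close> to the power
  \<open>\<i> * u\<close>, the expectation is Euler's integral for Gamma at
  \<open>1 + \<i> * u\<close>.\<close>

lemma integral_exponential_cis_ln:
  fixes u :: real
  defines "E \<equiv> density lborel (exponential_density 1)"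
  shows "(\<integral>x. cis (u * (ln x + c)) \<partial>E) = cis (u * c) * Gamma (1 + \<i> * u)"
proof -
  let ?g = "\<lambda>t. complex_of_real t powr (1 + \<i> * u - 1) / of_real (exp t)"
  have abs: "?g absolutely_integrable_on {0<..}"
    by (rule absolutely_integrable_Gamma_integral') simp
  have g_borel: "(\<lambda>x. indicator {0<..} x *\<^sub>R ?g x) \<in> borel_measurable lborel"
    by (simp, intro borel_measurable_continuous_on_indicator continuous_intros) auto
  \<comment> \<open>Euler's integral starts as a gauge integral. Absolute integrability makes it a
    Lebesgue integral, and Borel measurability passes from \<open>lebesgue\<close> to
    \<open>lborel\<close>.\<close>
  have "Gamma (1 + \<i> * u) = integral {0<..} ?g"
    using Gamma_integral_complex'[of "1 + \<i> * u"] by (simp add: integral_unique)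
  also have "\<dots> = (\<integral>x. indicator {0<..} x *\<^sub>R ?g x \<partial>lebesgue)"
    using set_lebesgue_integral_eq_integral(2)[OF abs] by (simp add: set_lebesgue_integral_def)
  also have "\<dots> = (\<integral>x. indicator {0<..} x *\<^sub>R ?g x \<partial>lborel)"
    unfolding g_borel[THEN integral_completion] ..
  finally have G: "Gamma (1 + \<i> * u) = (\<integral>x. indicator {0<..} x *\<^sub>R ?g x \<partial>lborel)" .
  have "(\<integral>x. cis (u * (ln x + c)) \<partial>E) 
       = (\<integral>x. exponential_density 1 x *\<^sub>R cis (u * (ln x + c)) \<partial>lborel)"
    unfolding E_def by (subst integral_density) (auto simp: cis_conv_exp exponential_density_nonneg)
  also have "\<dots> = (\<integral>x. cis (u * c) * (indicator {0<..} x *\<^sub>R ?g x) \<partial>lborel)"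
  proof (intro integral_cong_AE)
    show "AE x in lborel. exponential_density 1 x *\<^sub>R cis (u * (ln x + c))
            = cis (u * c) * (indicator {0<..} x *\<^sub>R ?g x)"
      using AE_lborel_singleton[of 0]
    proof eventually_elim
      case (elim x)
      then consider "x < 0" | "x > 0" by linarith
      thus ?case
      proof cases
        case 2
        hence "complex_of_real x powr (\<i> * u) = cis (u * ln x)"
          by (simp add: powr_def cis_conv_exp Ln_of_real mult_ac)
        thus ?thesis using 2
          by (simp add: exponential_density_def scaleR_conv_of_real distrib_left cis_mult[symmetric] 
              exp_minus field_simps)
      qed (simp add: exponential_density_def)
    qed
    show "(\<lambda>x. cis (u * c) * (indicator {0<..} x *\<^sub>R ?g x)) \<in> borel_measurable lborel"
      using g_borel by (rule borel_measurable_times[OF borel_measurable_const])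
  qed (auto simp: cis_conv_exp)
  also have "\<dots> = cis (u * c) * Gamma (1 + \<i> * u)"
    unfolding G by (rule integral_mult_right_zero)
  finally show ?thesis .
qed

text \<open>The value is Gamma at 1/2. It bounds the mean rounding error when geometric and
  exponential laws are compared.\<close>

lemma has_bochner_integral_exponential_inverse_sqrt:
  defines "E \<equiv> density lborel (exponential_density 1)"
  shows "has_bochner_integral E (\<lambda>x. 1 / sqrt x) (sqrt pi)"
proof -
  have eq: "AE x in lborel. exponential_density 1 x *\<^sub>R (1 / sqrt x) = indicator {0..} x * x powr (1/2 - 1) / exp x"
    using AE_lborel_singleton[of 0]
    by eventually_elim 
      (auto simp: exponential_density_def indicator_def exp_minus powr_half_sqrt[symmetric] 
          powr_minus_divide field_simps)
  have "has_bochner_integral lborel (\<lambda>x. indicator {0..} x * x powr (1/2 - 1) / exp x) (Gamma (1/2 :: real))"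
    using Gamma_conv_nn_integral_real[of "1/2"]
    by (intro has_bochner_integral_nn_integral) (auto simp: Gamma_one_half_real)
  hence "has_bochner_integral lborel (\<lambda>x. exponential_density 1 x *\<^sub>R (1 / sqrt x)) (sqrt pi)"
    by (subst has_bochner_integral_cong_AE[OF _ _ eq]) (auto simp: Gamma_one_half_real)
  thus ?thesis
    unfolding E_def by (intro has_bochner_integral_density) (auto simp: exponential_density_nonneg)
qed

text \<open>The error is at most \<open>ln (1 + 1/x)\<close>, and \<open>1 + 1/x\<close> is at most
  \<open>(1 + 1/sqrt x)^2\<close>. The bound \<open>2 / sqrt x\<close> is preferred to
  \<open>1 / x\<close> because the latter is not integrable near 0 against the exponential
  density.\<close>

lemma ln_real_ceiling_diff_le:
  assumes "x > 0"
  shows "\<bar>ln (real (nat \<lceil>x\<rceil>)) - ln x\<bar> \<le> 2 / sqrt x"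
proof -
  have c: "x \<le> real (nat \<lceil>x\<rceil>)" "real (nat \<lceil>x\<rceil>) \<le> x + 1" using assms by linarith+
  have "ln (real (nat \<lceil>x\<rceil>)) - ln x \<le> ln (x + 1) - ln x" using c assms by simp
  also have "\<dots> = ln (1 + 1 / x)" using assms ln_div[of "x + 1" x] by (simp add: add_divide_distrib)
  also have "\<dots> \<le> ln ((1 + 1 / sqrt x)\<^sup>2)"
    using assms by (subst ln_le_cancel_iff) (auto simp: power2_sum power_divide add_pos_pos)
  also have "\<dots> = 2 * ln (1 + 1 / sqrt x)" using assms by (simp add: ln_realpow add_pos_pos)
  also have "\<dots> \<le> 2 * (1 / sqrt x)" using assms by (intro mult_left_mono ln_add_one_self_le_self) auto
  finally show ?thesis using c assms by simp
qed

text \<open>A coupling: with this \<open>r\<close> the ceiling of \<open>x / r\<close> is geometric,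
  and its logarithm minus \<open>ln N\<close> differs from \<open>ln x\<close> by the rounding error
  of \<open>x / r\<close> and by \<open>ln (r * N)\<close>. Both are at most of order
  \<open>1 / sqrt N\<close> in mean, and \<open>cis\<close> is 1-Lipschitz.\<close>

lemma expectation_cis_ln_ceiling_exponential:
  fixes u N :: real
  assumes N: "N \<ge> 2"
  defines "E \<equiv> density lborel (exponential_density 1)" and "r \<equiv> - ln (1 - 1 / N)"
  shows "norm ((\<integral>x. cis (u * (ln (real (nat \<lceil>x / r\<rceil>)) - ln N + c)) \<partial>E) 
           - cis (u * c) * Gamma (1 + \<i> * u)) \<le> 8 * \<bar>u\<bar> / sqrt N"
proof -
  interpret E: prob_space E unfolding E_def by (rule prob_space_exponential_density) simp
  have [measurable_cong]: "sets E = sets borel" by (simp add: E_def)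
  have [measurable]: "cis \<in> borel_measurable borel"
    by (intro borel_measurable_continuous_onI continuous_intros)
  have r_lower: "r \<ge> 1 / N" using N ln_le_minus_one[of "1 - 1/N"] by (simp add: r_def)
  hence r: "r > 0" using N by (smt (verit) divide_pos_pos)
  have "r = ln (1 + 1 / (N - 1))" 
    using N by (simp add: r_def ln_inverse[symmetric] field_simps ln_div)
  also have "\<dots> \<le> 1 / (N - 1)" using N by (intro ln_add_one_self_le_self) auto
  finally have r_upper: "r \<le> 1 / (N - 1)" .
  have r_le: "r \<le> 2 / N" using N by (intro order.trans[OF r_upper]) (simp add: field_simps)
  \<comment> \<open>The bound obtained is \<open>exp r\<close>, so \<open>ln (r * N)\<close> is at
    most \<open>r\<close>.\<close>
  have "r * N \<le> 1 / (N - 1) * N" using r_upper N by (intro mult_right_mono) auto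
  also have "\<dots> = 1 + 1 / (N - 1)" using N by (simp add: field_simps)
  finally have "ln (r * N) \<le> ln (1 + 1 / (N - 1))"
    using r N by (subst ln_le_cancel_iff) (auto simp: add_pos_pos)
  also have "\<dots> = r" using N by (simp add: r_def ln_inverse[symmetric] field_simps ln_div)
  also note r_le
  also have "2 / N \<le> 2 / sqrt N" using N by (simp add: frac_le real_sqrt_le_iff' power2_eq_square real_le_lsqrt)
  finally have ln1: "ln (r * N) \<le> 2 / sqrt N" .
  have ln0: "ln (r * N) \<ge> 0" using r_lower N by (intro ln_ge_zero) (simp add: field_simps)
  let ?h = "\<lambda>x. \<bar>u\<bar> * (2 * sqrt r * (1 / sqrt x) + 2 / sqrt N)"
  have int: "has_bochner_integral E ?h (\<bar>u\<bar> * (2 * sqrt r * sqrt pi + 2 / sqrt N))"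
    using has_bochner_integral_exponential_inverse_sqrt E.prob_space 
    by (intro has_bochner_integral_mult_right has_bochner_integral_add)
      (auto simp: E_def[symmetric] has_bochner_integral_iff)
  have int1: "integrable E (\<lambda>x. cis (u * (ln (real (nat \<lceil>x / r\<rceil>)) - ln N + c)))"
    by (rule E.integrable_const_bound[of _ 1]) auto
  have int2: "integrable E (\<lambda>x. cis (u * (ln x + c)))"
    by (rule E.integrable_const_bound[of _ 1]) auto
  have AE_pos: "AE x in E. x > 0"
    unfolding E_def by (subst AE_density) (use AE_lborel_singleton[of 0] in 
      \<open>auto elim!: eventually_mono simp: exponential_density_def\<close>)
  have "norm ((\<integral>x. cis (u * (ln (real (nat \<lceil>x / r\<rceil>)) - ln N + c)) \<partial>E) 
           - cis (u * c) * Gamma (1 + \<i> * u))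
       = norm (\<integral>x. cis (u * (ln (real (nat \<lceil>x / r\<rceil>)) - ln N + c)) - cis (u * (ln x + c)) \<partial>E)"
    using int1 int2 integral_exponential_cis_ln[of u c] by (simp add: E_def)
  also have "\<dots> \<le> (\<integral>x. norm (cis (u * (ln (real (nat \<lceil>x / r\<rceil>)) - ln N + c)) - cis (u * (ln x + c))) \<partial>E)"
    by (rule integral_norm_bound)
  also have "\<dots> \<le> (\<integral>x. ?h x \<partial>E)"
  proof (rule integral_mono_AE)
    show "integrable E (\<lambda>x. norm (cis (u * (ln (real (nat \<lceil>x / r\<rceil>)) - ln N + c)) - cis (u * (ln x + c))))"
      using int1 int2 by simp
    show "integrable E ?h" using int by (simp add: has_bochner_integral_iff)
    show "AE x in E. norm (cis (u * (ln (real (nat \<lceil>x / r\<rceil>)) - ln N + c)) - cis (u * (ln x + c))) \<le> ?h x"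
      using AE_pos
    proof eventually_elim
      case (elim x)
      have "norm (cis (u * (ln (real (nat \<lceil>x / r\<rceil>)) - ln N + c)) - cis (u * (ln x + c)))
          \<le> \<bar>u * (ln (real (nat \<lceil>x / r\<rceil>)) - ln N + c) - u * (ln x + c)\<bar>"
        by (rule norm_cis_diff_le)
      also have "\<dots> = \<bar>u\<bar> * \<bar>(ln (real (nat \<lceil>x / r\<rceil>)) - ln (x / r)) - ln (r * N)\<bar>"
        using elim r N by (simp add: ln_div ln_mult abs_mult[symmetric] algebra_simps)
      also have "\<dots> \<le> \<bar>u\<bar> * (2 / sqrt (x / r) + 2 / sqrt N)"
        using ln_real_ceiling_diff_le[of "x / r"] divide_pos_pos[OF elim r] ln0 ln1
          by (intro mult_left_mono) linarith+
      also have "\<dots> = ?h x" using r elim by (simp add: real_sqrt_divide)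
      finally show ?case .
    qed
  qed
  also have "\<dots> = \<bar>u\<bar> * (2 * sqrt r * sqrt pi + 2 / sqrt N)"
    using int by (rule has_bochner_integral_integral_eq)
  \<comment> \<open>Here 8 = 2 * 3 + 2: \<open>sqrt (r * pi)\<close> is at most
    \<open>sqrt (8 / N)\<close>, which is rounded up to \<open>3 / sqrt N\<close>.\<close>
  also have "\<dots> \<le> \<bar>u\<bar> * (8 / sqrt N)"
  proof (rule mult_left_mono)
    have "sqrt r * sqrt pi \<le> sqrt (2 / N * 4)"
      unfolding real_sqrt_mult[symmetric] using r_le r pi_less_4 N by (intro real_sqrt_le_mono mult_mono) auto
    also have "\<dots> \<le> sqrt (9 / N)" using N by (intro real_sqrt_le_mono) (simp add: field_simps)
    also have "\<dots> = 3 / sqrt N" by (simp add: real_sqrt_divide)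
    finally show "2 * sqrt r * sqrt pi + 2 / sqrt N \<le> 8 / sqrt N" by simp
  qed simp
  finally show ?thesis by (simp add: mult.commute)
qed

text \<open>Summation by parts: the sum telescopes and stops at \<open>t\<close>, or at
  \<open>Suc n\<close> if that comes first. The cutoff \<open>n\<close> keeps the combination of
  tail indicators finite.\<close>

lemma sum_increments_min:
  fixes f :: "nat \<Rightarrow> complex"
  assumes "t \<ge> 1"
  shows "f 1 + (\<Sum>s=1..n. (f (Suc s) - f s) * of_bool (s < t)) = f (min t (Suc n))"
proof (induction n)
  case (Suc n)
  have "f 1 + (\<Sum>s=1..Suc n. (f (Suc s) - f s) * of_bool (s < t)) 
      = f (min t (Suc n)) + (f (Suc (Suc n)) - f (Suc n)) * of_bool (Suc n < t)"
    unfolding Suc.IH[symmetric] by (simp del: sum_mult_of_bool_eq)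
  also have "\<dots> = f (min t (Suc (Suc n)))"
    by (cases "t \<le> Suc n") (auto simp: min_def le_Suc_eq)
  finally show ?case .
qed (use assms in simp)

text \<open>The mean of the truncated variable is a finite combination of tail probabilities, and
  dominated convergence lifts the truncation. Two variables with the same tails thus get the same
  mean of \<open>f\<close>, without a closed form for it.\<close>

lemma (in prob_space) geometric_tail_integral_LIMSEQ:
  fixes T :: "'a \<Rightarrow> nat" and f :: "nat \<Rightarrow> complex"
  assumes [measurable]: "T \<in> measurable M (count_space UNIV)"
    and T_pos: "AE x in M. T x \<ge> 1"
    and tail: "\<And>s. s \<ge> 1 \<Longrightarrow> prob {x \<in> space M. s < T x} = q ^ s"
    and f: "\<And>t. norm (f t) \<le> 1"
  shows "(\<lambda>n. f 1 + (\<Sum>s=1..n. (f (Suc s) - f s) * q ^ s)) \<longlonglongrightarrow> (\<integral>x. f (T x) \<partial>M)"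
proof -
  have "(\<integral>x. f (min (T x) (Suc n)) \<partial>M) = f 1 + (\<Sum>s=1..n. (f (Suc s) - f s) * q ^ s)" for n
  proof -
    have int: "integrable M (\<lambda>x. of_bool (s < T x) :: complex)" for s
      by (rule integrable_const_bound[of _ 1]) auto
    have P: "(\<integral>x. (of_bool (s < T x) :: complex) \<partial>M) = q ^ s" if "s \<ge> 1" for s
    proof -
      have "(\<integral>x. (of_bool (s < T x) :: complex) \<partial>M) = (\<integral>x. of_real (indicator {x \<in> space M. s < T x} x) \<partial>M)"
        by (intro Bochner_Integration.integral_cong) (auto simp: indicator_def)
      also have "\<dots> = complex_of_real (\<integral>x. indicator {x \<in> space M. s < T x} x \<partial>M)"
        by (rule integral_complex_of_real)
      finally show ?thesis using tail[OF that] by simp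
    qed
    have "(\<integral>x. f (min (T x) (Suc n)) \<partial>M)
        = (\<integral>x. f 1 + (\<Sum>s=1..n. (f (Suc s) - f s) * of_bool (s < T x)) \<partial>M)"
      using T_pos by (intro integral_cong_AE) (auto elim!: eventually_mono simp: sum_increments_min[symmetric])
    also have "\<dots> = f 1 + (\<Sum>s=1..n. (f (Suc s) - f s) * (\<integral>x. of_bool (s < T x) \<partial>M))"
      using int by (simp add: prob_space del: sum_mult_of_bool_eq)
    finally show ?thesis using P by simp
  qed
  moreover have "(\<lambda>n. \<integral>x. f (min (T x) (Suc n)) \<partial>M) \<longlonglongrightarrow> (\<integral>x. f (T x) \<partial>M)"
  proof (rule integral_dominated_convergence[where w = "\<lambda>_. 1"])
    show "AE x in M. (\<lambda>n. f (min (T x) (Suc n))) \<longlonglongrightarrow> f (T x)"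
    proof (rule AE_I2)
      fix x
      have "\<forall>\<^sub>F n in sequentially. f (min (T x) (Suc n)) = f (T x)"
        using eventually_ge_at_top[of "T x"] by eventually_elim (simp add: min_def)
      thus "(\<lambda>n. f (min (T x) (Suc n))) \<longlonglongrightarrow> f (T x)" by (rule tendsto_eventually)
    qed
  qed (use f in auto)
  ultimately show ?thesis by simp
qed

text \<open>For standard exponential \<open>x\<close>, the ceiling of \<open>x / - ln q\<close>
  exceeds \<open>s\<close> exactly when \<open>x\<close> exceeds \<open>- s * ln q\<close>, an event
  of probability \<open>q ^ s\<close>. So the ceiling has geometric tails.\<close>

lemma geometric_sum_LIMSEQ_exponential:
  fixes f :: "nat \<Rightarrow> complex" and q :: real
  assumes q: "0 < q" "q < 1" and f: "\<And>t. norm (f t) \<le> 1"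
  shows "(\<lambda>n. f 1 + (\<Sum>s=1..n. (f (Suc s) - f s) * q ^ s))
      \<longlonglongrightarrow> (\<integral>x. f (nat \<lceil>x / - ln q\<rceil>) \<partial>density lborel (exponential_density 1))"
proof -
  define E where "E = density lborel (exponential_density 1)"
  interpret E: prob_space E unfolding E_def by (rule prob_space_exponential_density) simp
  have [measurable_cong]: "sets E = sets borel" by (simp add: E_def)
  have r: "- ln q > 0" using q by simp
  have D: "distributed E lborel (\<lambda>x. x) (exponential_density 1)"
    unfolding distributed_def by (auto simp: E_def distr_id2)
  show ?thesis unfolding E_def[symmetric]
  proof (rule E.geometric_tail_integral_LIMSEQ)
    show "AE x in E. nat \<lceil>x / - ln q\<rceil> \<ge> 1"
      using AE_lborel_singleton[of 0] r unfolding E_def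
      by (subst AE_density) (auto elim!: eventually_mono simp: exponential_density_def zero_less_divide_iff
           divide_less_0_iff Suc_le_eq)
    fix s :: nat
    have "s < nat \<lceil>x / - ln q\<rceil> \<longleftrightarrow> real s * (- ln q) < x" for x
      using r pos_less_divide_eq[OF r, of "real s" x]
      by (simp add: zless_nat_eq_int_zless less_ceiling_iff del: minus_divide_right)
    hence "E.prob {x \<in> space E. s < nat \<lceil>x / - ln q\<rceil>} = E.prob {x \<in> space E. real s * (- ln q) < x}"
      by simp
    also have "\<dots> = exp (- (real s * (- ln q)) * 1)"
      using r by (intro E.exponential_distributedD_gt[OF D] mult_nonneg_nonneg) auto
    also have "\<dots> = q ^ s" using q by (simp add: exp_of_nat_mult)
    finally show "E.prob {x \<in> space E. s < nat \<lceil>x / - ln q\<rceil>} = q ^ s" .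
  qed (use f in auto)
qed

subsection \<open>First occurrence times in a uniform random stream\<close>

lemma measurable_Inf_Collect_nat:
  fixes P :: "nat \<Rightarrow> 'a \<Rightarrow> bool"
  assumes "\<And>t. Measurable.pred M (P t)"
  shows "(\<lambda>x. Inf {t. P t x}) \<in> measurable M (count_space UNIV)"
  unfolding Inf_nat_def mem_Collect_eq using assms by (rule measurable_Least)

text \<open>This turns the one-step formula for nonnegative integrals into an identity of measures,
  from which complex integrands can be treated by Fubini.\<close>

lemma (in prob_space) distr_Stream:
  "distr (M \<Otimes>\<^sub>M stream_space M) (stream_space M) (\<lambda>(x, \<omega>). x ## \<omega>) = stream_space M"
proof (rule measure_eqI)
  interpret S: prob_space "stream_space M" by (rule prob_space_stream_space)
  fix X assume "X \<in> sets (distr (M \<Otimes>\<^sub>M stream_space M) (stream_space M) (\<lambda>(x, \<omega>). x ## \<omega>))"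
  hence X [measurable]: "X \<in> sets (stream_space M)" by simp
  have "emeasure (distr (M \<Otimes>\<^sub>M stream_space M) (stream_space M) (\<lambda>(x, \<omega>). x ## \<omega>)) X
      = (\<integral>\<^sup>+z. indicator X (fst z ## snd z) \<partial>(M \<Otimes>\<^sub>M stream_space M))"
    by (subst nn_integral_indicator[symmetric], simp, subst nn_integral_distr) (auto simp: case_prod_beta)
  also have "\<dots> = (\<integral>\<^sup>+x. \<integral>\<^sup>+\<omega>. indicator X (x ## \<omega>) \<partial>stream_space M \<partial>M)"
    by (subst S.nn_integral_fst[symmetric]) auto
  also have "\<dots> = (\<integral>\<^sup>+\<omega>. indicator X \<omega> \<partial>stream_space M)"
    by (rule nn_integral_stream_space[symmetric]) simp
  finally show "emeasure (distr (M \<Otimes>\<^sub>M stream_space M) (stream_space M) (\<lambda>(x, \<omega>). x ## \<omega>)) X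
      = emeasure (stream_space M) X" by simp
qed simp

lemma (in prob_space) integral_stream_space:
  fixes f :: "'a stream \<Rightarrow> 'b :: {banach, second_countable_topology}"
  assumes f: "integrable (stream_space M) f"
  shows "(\<integral>\<omega>. f \<omega> \<partial>stream_space M) = (\<integral>x. (\<integral>\<omega>. f (x ## \<omega>) \<partial>stream_space M) \<partial>M)"
proof -
  interpret S: prob_space "stream_space M" by (rule prob_space_stream_space)
  interpret P: pair_sigma_finite M "stream_space M" ..
  have [measurable]: "f \<in> borel_measurable (stream_space M)" using f by simp
  have "integrable (distr (M \<Otimes>\<^sub>M stream_space M) (stream_space M) (\<lambda>(x, \<omega>). x ## \<omega>)) f"
    using f by (simp add: distr_Stream)
  hence "integrable (M \<Otimes>\<^sub>M stream_space M) (\<lambda>z. f (fst z ## snd z))"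
    by (subst (asm) integrable_distr_eq) (auto simp: case_prod_beta)
  note int = P.integral_fst'[OF this]
  have "(\<integral>\<omega>. f \<omega> \<partial>stream_space M) 
      = (\<integral>\<omega>. f \<omega> \<partial>distr (M \<Otimes>\<^sub>M stream_space M) (stream_space M) (\<lambda>(x, \<omega>). x ## \<omega>))"
    by (simp only: distr_Stream)
  also have "\<dots> = (\<integral>z. f (fst z ## snd z) \<partial>(M \<Otimes>\<^sub>M stream_space M))"
    by (subst integral_distr) (auto simp: case_prod_beta)
  finally show ?thesis using int by simp
qed

text \<open>The squared modulus expands into a double sum with coefficients
  \<open>Re (a i * cnj (a j))\<close>. Only the mixed moments of the real variables
  \<open>\<xi>\<close> then remain to be estimated.\<close>

lemma (in prob_space) norm_weighted_sum_second_moment_le: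
  fixes a :: "'i \<Rightarrow> complex" and \<xi> :: "'i \<Rightarrow> 'a \<Rightarrow> real"
  assumes "finite I" and int: "\<And>i j. i \<in> I \<Longrightarrow> j \<in> I \<Longrightarrow> integrable M (\<lambda>x. \<xi> i x * \<xi> j x)"
  shows "(\<integral>x. (norm (\<Sum>i\<in>I. a i * \<xi> i x))\<^sup>2 \<partial>M)
      \<le> (\<Sum>i\<in>I. \<Sum>j\<in>I. norm (a i) * norm (a j) * \<bar>\<integral>x. \<xi> i x * \<xi> j x \<partial>M\<bar>)"
proof -
  have sq: "(norm (\<Sum>i\<in>I. a i * \<xi> i x))\<^sup>2 = (\<Sum>i\<in>I. \<Sum>j\<in>I. Re (a i * cnj (a j)) * (\<xi> i x * \<xi> j x))" for x
  proof -
    have "complex_of_real ((norm (\<Sum>i\<in>I. a i * \<xi> i x))\<^sup>2) 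
        = (\<Sum>i\<in>I. a i * \<xi> i x) * cnj (\<Sum>i\<in>I. a i * \<xi> i x)"
      by (rule complex_norm_square)
    also have "\<dots> = (\<Sum>i\<in>I. \<Sum>j\<in>I. (a i * cnj (a j)) * of_real (\<xi> i x * \<xi> j x))"
      by (simp add: sum_product mult_ac)
    finally have "Re (complex_of_real ((norm (\<Sum>i\<in>I. a i * \<xi> i x))\<^sup>2)) 
        = Re (\<Sum>i\<in>I. \<Sum>j\<in>I. (a i * cnj (a j)) * of_real (\<xi> i x * \<xi> j x))" by (rule arg_cong)
    also have "\<dots> = (\<Sum>i\<in>I. \<Sum>j\<in>I. Re ((a i * cnj (a j)) * of_real (\<xi> i x * \<xi> j x)))"
      by (simp only: Re_sum)
    also have "\<dots> = (\<Sum>i\<in>I. \<Sum>j\<in>I. Re (a i * cnj (a j)) * (\<xi> i x * \<xi> j x))"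
      by (simp only: Re_complex_of_real times_complex.sel Im_complex_of_real mult_zero_right diff_0_right)
    finally show ?thesis by (simp only: Re_complex_of_real)
  qed
  have "(\<integral>x. (norm (\<Sum>i\<in>I. a i * \<xi> i x))\<^sup>2 \<partial>M)
      = (\<Sum>i\<in>I. \<Sum>j\<in>I. Re (a i * cnj (a j)) * (\<integral>x. \<xi> i x * \<xi> j x \<partial>M))"
    unfolding sq using int by (simp add: Bochner_Integration.integral_sum del: times_complex.sel)
  also have "\<dots> \<le> (\<Sum>i\<in>I. \<Sum>j\<in>I. norm (a i) * norm (a j) * \<bar>\<integral>x. \<xi> i x * \<xi> j x \<partial>M\<bar>)"
  proof (intro sum_mono)
    fix i j
    have "Re (a i * cnj (a j)) * (\<integral>x. \<xi> i x * \<xi> j x \<partial>M)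
        \<le> \<bar>Re (a i * cnj (a j))\<bar> * \<bar>\<integral>x. \<xi> i x * \<xi> j x \<partial>M\<bar>"
      by (metis abs_ge_self abs_mult)
    also have "\<dots> \<le> norm (a i * cnj (a j)) * \<bar>\<integral>x. \<xi> i x * \<xi> j x \<partial>M\<bar>"
      by (intro mult_right_mono abs_Re_le_cmod) auto
    finally show "Re (a i * cnj (a j)) * (\<integral>x. \<xi> i x * \<xi> j x \<partial>M)
        \<le> norm (a i) * norm (a j) * \<bar>\<integral>x. \<xi> i x * \<xi> j x \<partial>M\<bar>" by (simp add: norm_mult)
  qed
  finally show ?thesis .
qed

text \<open>For \<open>s \<le> t\<close> the summand is \<open>q ^ t / t\<close>. Summing it over
  the \<open>t\<close> values of \<open>s\<close> leaves \<open>q ^ t\<close>, so by symmetry the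
  total is at most twice a geometric series.\<close>

lemma sum_min_power_max_le:
  fixes q :: real
  assumes q: "0 \<le> q" "q < 1"
  shows "(\<Sum>s=1..n. \<Sum>t=1..n. 1 / real s * (1 / real t) * (real (min s t) * q ^ max s t)) \<le> 2 / (1 - q)"
proof -
  \<comment> \<open>The sum \<open>h s t + h t s\<close> counts the diagonal twice, so there it only
    dominates the summand.\<close>
  define h where "h = (\<lambda>s t. if s \<le> t then q ^ t / real t else 0)"
  have "(\<Sum>s=1..n. \<Sum>t=1..n. 1 / real s * (1 / real t) * (real (min s t) * q ^ max s t)) 
      \<le> (\<Sum>s=1..n. \<Sum>t=1..n. h s t + h t s)"
    using q by (intro sum_mono) (auto simp: h_def min_def max_def intro!: divide_right_mono)
  also have "\<dots> = 2 * (\<Sum>t=1..n. \<Sum>s=1..n. h s t)"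
    by (simp add: sum.distrib) (rule sum.swap)
  also have "(\<Sum>t=1..n. \<Sum>s=1..n. h s t) = (\<Sum>t=1..n. q ^ t)"
  proof (rule sum.cong)
    fix t assume t: "t \<in> {1..n}"
    have "(\<Sum>s=1..n. h s t) = (\<Sum>s=1..t. q ^ t / real t)"
      using t by (intro sum.mono_neutral_cong_right) (auto simp: h_def)
    also have "\<dots> = q ^ t" using t by simp
    finally show "(\<Sum>s=1..n. h s t) = q ^ t" .
  qed simp
  also have "(\<Sum>t=1..n. q ^ t) \<le> (\<Sum>t. q ^ t)"
    using q by (intro sum_le_suminf summable_geometric) auto
  also have "\<dots> = 1 / (1 - q)" using q by (intro suminf_geometric) auto
  finally show ?thesis by simp
qed

text \<open>Positions count from 1, so that after dropping the blocks up to a given one this is its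
  return time. A stream without \<open>b\<close> gets the value \<open>Inf {}\<close>.\<close>

definition first_occ :: "'a \<Rightarrow> 'a stream \<Rightarrow> nat" where
  "first_occ b \<omega> = Inf {t. 1 \<le> t \<and> \<omega> !! (t - 1) = b}"

text \<open>Finite-horizon form of the event that the waiting time for \<open>b\<close> exceeds
  \<open>s\<close>. It depends on the first \<open>s\<close> letters only, so its probability
  follows by induction.\<close>

definition absent :: "nat \<Rightarrow> 'a \<Rightarrow> 'a stream \<Rightarrow> bool" where
  "absent s b \<omega> \<longleftrightarrow> (\<forall>i<s. \<omega> !! i \<noteq> b)"

lemma absent_0 [simp]: "absent 0 b \<omega>"
  by (simp add: absent_def)

text \<open>An occurrence of \<open>b\<close> makes the set of times nonempty, so its infimum is
  attained. If \<open>b\<close> never occurs, \<open>absent s b \<omega>\<close> holds for every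
  \<open>s\<close> although \<open>first_occ b \<omega>\<close> is a fixed number.\<close>

lemma absent_iff_less_first_occ:
  assumes "\<omega> !! i = b"
  shows "absent s b \<omega> \<longleftrightarrow> s < first_occ b \<omega>" and "first_occ b \<omega> \<ge> 1"
proof -
  let ?X = "{t. 1 \<le> t \<and> \<omega> !! (t - 1) = b}"
  have "Suc i \<in> ?X" using assms by simp
  hence mem: "first_occ b \<omega> \<in> ?X" unfolding first_occ_def by (intro Inf_nat_def1) auto
  thus "first_occ b \<omega> \<ge> 1" by simp
  have le: "first_occ b \<omega> \<le> Suc j" if "\<omega> !! j = b" for j
    unfolding first_occ_def using that by (intro cInf_lower) auto
  show "absent s b \<omega> \<longleftrightarrow> s < first_occ b \<omega>"
  proof
    assume "absent s b \<omega>"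
    show "s < first_occ b \<omega>"
    proof (rule ccontr)
      assume "\<not> s < first_occ b \<omega>"
      hence "first_occ b \<omega> - 1 < s" using mem by auto
      thus False using mem \<open>absent s b \<omega>\<close> by (auto simp: absent_def)
    qed
  next
    assume "s < first_occ b \<omega>"
    thus "absent s b \<omega>" using le by (fastforce simp: absent_def)
  qed
qed

section \<open>Absence probabilities and covariances for uniform letters\<close>

locale uniform_stream =
  fixes B :: "'a set"
  assumes finite_B: "finite B" and card_B: "card B \<ge> 2"
begin

abbreviation "N \<equiv> real (card B)"
abbreviation "q \<equiv> 1 - 1 / N"
abbreviation "S \<equiv> stream_space (uniform_count_measure B)"

lemma N_ge_2: "N \<ge> 2" using card_B by simp

sublocale U: prob_space "uniform_count_measure B"
  using finite_B card_B by (intro prob_space_uniform_count_measure) auto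

sublocale S: prob_space S by (rule U.prob_space_stream_space)

lemma space_S: "space S = streams B"
  by (simp add: space_stream_space space_uniform_count_measure)

lemma pred_snth_eq [measurable]: "Measurable.pred S (\<lambda>\<omega>. \<omega> !! i = b)"
proof -
  have "(\<lambda>x. x = b) \<in> measurable (uniform_count_measure B) (count_space UNIV)"
    by (auto simp: measurable_def sets_uniform_count_measure space_uniform_count_measure)
  from measurable_compose[OF measurable_snth this] show ?thesis .
qed

lemma pred_snth_eq_snth [measurable]: "Measurable.pred S (\<lambda>\<omega>. \<omega> !! i = \<omega> !! j)"
proof -
  \<comment> \<open>Finiteness of \<open>B\<close> expresses equality of two letters as a finite
    union of events.\<close>
  have "Measurable.pred S (\<lambda>\<omega>. \<exists>b\<in>B. \<omega> !! i = b \<and> \<omega> !! j = b)"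
    using finite_B by measurable
  also have "?this \<longleftrightarrow> ?thesis"
    by (intro measurable_cong) (auto simp: space_S streams_iff_snth)
  finally show ?thesis .
qed

lemma measurable_first_occ [measurable]: "first_occ b \<in> measurable S (count_space UNIV)"
  unfolding first_occ_def[abs_def] by (intro measurable_Inf_Collect_nat) measurable

lemma measurable_return_time [measurable]:
  "(\<lambda>\<omega>. first_occ (\<omega> !! i) (sdrop j \<omega>)) \<in> measurable S (count_space UNIV)"
  unfolding first_occ_def[abs_def] sdrop_snth by (intro measurable_Inf_Collect_nat) measurable

lemma pred_absent [measurable]: "Measurable.pred S (absent s b)"
  unfolding absent_def[abs_def] by measurable

lemma integral_S:
  fixes f :: "'a stream \<Rightarrow> 'b :: {banach, second_countable_topology}"
  assumes "integrable S f"
  shows "(\<integral>\<omega>. f \<omega> \<partial>S) = (1 / N) *\<^sub>R (\<Sum>x\<in>B. \<integral>\<omega>. f (x ## \<omega>) \<partial>S)"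
proof -
  have "integral\<^sup>L (uniform_count_measure B) g = (1 / N) *\<^sub>R (\<Sum>x\<in>B. g x)" for g :: "'a \<Rightarrow> 'b"
    unfolding uniform_count_measure_def
    using finite_B by (subst lebesgue_integral_point_measure_finite) (auto simp: scaleR_sum_right)
  thus ?thesis by (simp add: U.integral_stream_space[OF assms])
qed

text \<open>Both letters are avoided in the first \<open>s\<close> places and only \<open>b\<close>
  in the next \<open>t\<close>. Writing \<open>card {a, b}\<close> covers equal and distinct letters
  at once.\<close>

lemma integral_absent:
  assumes "a \<in> B" "b \<in> B"
  shows "(\<integral>\<omega>. of_bool (absent s a \<omega>) * of_bool (absent (s + t) b \<omega>) \<partial>S) 
      = (1 - real (card {a, b}) / N) ^ s * q ^ t"
proof -
  \<comment> \<open>One-step recursion: the first letter avoids \<open>A\<close> independently of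
    the rest of the stream.\<close>
  have step: "(\<integral>\<omega>. of_bool (shd \<omega> \<notin> A) * g (stl \<omega>) \<partial>S) = (1 - real (card A) / N) * (\<integral>\<omega>. g \<omega> \<partial>S)"
    if [measurable]: "g \<in> borel_measurable S" and g: "\<And>\<omega>. \<bar>g \<omega>\<bar> \<le> 1" and A: "A \<subseteq> B"
    for A and g :: "'a stream \<Rightarrow> real"
  proof -
    have [measurable]: "A \<in> sets (uniform_count_measure B)" using A by (simp add: sets_uniform_count_measure)
    have "(\<integral>\<omega>. of_bool (shd \<omega> \<notin> A) * g (stl \<omega>) \<partial>S) 
        = (1 / N) * (\<Sum>x\<in>B. of_bool (x \<notin> A) * (\<integral>\<omega>. g \<omega> \<partial>S))"
      by (subst integral_S) (auto intro!: S.integrable_const_bound[of _ 1] simp: g)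
    also have "(\<Sum>x\<in>B. of_bool (x \<notin> A) * (\<integral>\<omega>. g \<omega> \<partial>S)) = real (card (B - A)) * (\<integral>\<omega>. g \<omega> \<partial>S)"
      using finite_B by (simp add: sum_distrib_right[symmetric] Int_def set_diff_eq del: sum_mult_of_bool_eq)
    also have "real (card (B - A)) = N - real (card A)"
      using A finite_B by (simp add: card_Diff_subset finite_subset card_mono of_nat_diff)
    finally show ?thesis using N_ge_2 by (simp add: field_simps)
  qed
  have q_step: "(\<integral>\<omega>. of_bool (absent t b \<omega>) \<partial>S) = q ^ t" for t
  proof (induction t)
    case (Suc t)
    have "(\<integral>\<omega>. (of_bool (absent (Suc t) b \<omega>) :: real) \<partial>S)
        = (\<integral>\<omega>. of_bool (shd \<omega> \<notin> {b}) * of_bool (absent t b (stl \<omega>)) \<partial>S)"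
      by (intro Bochner_Integration.integral_cong) (auto simp: absent_def All_less_Suc2)
    also have "\<dots> = q * q ^ t" using assms by (subst step) (auto simp: Suc)
    finally show ?case by simp
  qed (simp add: S.prob_space)
  show ?thesis
  proof (induction s)
    case (Suc s)
    have "(\<integral>\<omega>. (of_bool (absent (Suc s) a \<omega>) * of_bool (absent (Suc s + t) b \<omega>) :: real) \<partial>S)
        = (\<integral>\<omega>. of_bool (shd \<omega> \<notin> {a, b}) * (of_bool (absent s a (stl \<omega>)) * of_bool (absent (s + t) b (stl \<omega>))) \<partial>S)"
      by (intro Bochner_Integration.integral_cong) (auto simp: absent_def All_less_Suc2)
    also have "\<dots> = (1 - real (card {a, b}) / N) * ((1 - real (card {a, b}) / N) ^ s * q ^ t)" 
      using assms by (subst step) (auto simp: Suc)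
    finally show ?case by simp
  qed (simp add: q_step)
qed

lemma integral_absent_single:
  "b \<in> B \<Longrightarrow> (\<integral>\<omega>. of_bool (absent s b \<omega>) \<partial>S) = q ^ s"
  using integral_absent[of b b 0 s] by simp

lemma q_bounds: "1 / 2 \<le> q" "q < 1"
  using N_ge_2 by (auto simp: field_simps)

text \<open>For \<open>s \<le> t\<close> the covariance is \<open>q ^ t * (1 - q ^ s)\<close> if
  \<open>a = b\<close>, and \<open>- q ^ t * (q ^ s - y ^ s)\<close> with \<open>y\<close> close to
  \<open>q\<close> otherwise. The bound for distinct letters is smaller by a factor of order
  \<open>N\<close>, which compensates for the number of such pairs.\<close>

lemma covariance_absent:
  assumes "a \<in> B" "b \<in> B"
  shows "\<bar>\<integral>\<omega>. (of_bool (absent s a \<omega>) - q ^ s) * (of_bool (absent t b \<omega>) - q ^ t) \<partial>S\<bar>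
      \<le> (if a = b then 1 / N else 2 / N\<^sup>2) * (real (min s t) * q ^ max s t)"
  using assms
proof (induction s t arbitrary: a b rule: linorder_wlog)
  case (le s t)
  then obtain d where t: "t = s + d" using le_Suc_ex by blast
  have [simp]: "integrable S (\<lambda>\<omega>. of_bool (absent s b \<omega>) :: real)" for s b
    by (rule S.integrable_const_bound[of _ 1]) auto
  have [simp]: "integrable S (\<lambda>\<omega>. of_bool (absent s a \<omega>) * of_bool (absent t b \<omega>) :: real)"
    by (rule S.integrable_const_bound[of _ 1]) auto
  have "(\<integral>\<omega>. (of_bool (absent s a \<omega>) - q ^ s) * (of_bool (absent t b \<omega>) - q ^ t) \<partial>S)
      = (\<integral>\<omega>. of_bool (absent s a \<omega>) * of_bool (absent t b \<omega>) - q ^ t * of_bool (absent s a \<omega>)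
             - q ^ s * of_bool (absent t b \<omega>) + q ^ s * q ^ t \<partial>S)"
    by (simp add: algebra_simps)
  also have "\<dots> = (\<integral>\<omega>. of_bool (absent s a \<omega>) * of_bool (absent t b \<omega>) \<partial>S) - q ^ s * q ^ t"
    using le.prems by (simp add: integral_absent_single S.prob_space)
  also have "\<dots> = (1 - real (card {a, b}) / N) ^ s * q ^ d - q ^ s * q ^ t"
    unfolding t by (subst integral_absent) (use le.prems in auto)
  finally have eq: "(\<integral>\<omega>. (of_bool (absent s a \<omega>) - q ^ s) * (of_bool (absent t b \<omega>) - q ^ t) \<partial>S)
      = (1 - real (card {a, b}) / N) ^ s * q ^ d - q ^ s * q ^ t" .
  show ?case
  proof (cases "a = b")
    case True
    have "1 - q ^ s \<le> real s * (1 / N)"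
      using Bernoulli_inequality[of "- (1 / N)" s] N_ge_2 by simp
    hence "q ^ t * (1 - q ^ s) \<le> q ^ t * (real s * (1 / N))"
      using q_bounds by (intro mult_left_mono) auto
    moreover have "0 \<le> q ^ t * (1 - q ^ s)"
      using q_bounds by (intro mult_nonneg_nonneg) (auto simp: power_le_one)
    ultimately show ?thesis unfolding eq using True le.hyps
      by (simp add: t power_add algebra_simps min_def max_def)
  next
    case False
    \<comment> \<open>The probability that a letter differs from \<open>a\<close> given that it
      differs from \<open>b\<close>. It falls short of \<open>q\<close> only by order
      \<open>1 / N^2\<close>.\<close>
    define y where "y = (1 - 2 / N) / q"
    have y: "0 \<le> y" "y \<le> q" and diff: "q - y = 1 / (N\<^sup>2 * q)"
      using N_ge_2 q_bounds by (auto simp: y_def field_simps power2_eq_square)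
    have "q ^ s - y ^ s \<le> real s * (q - y)"
      using norm_power_diff[of q y s] y q_bounds by simp
    also have "q - y \<le> 2 / N\<^sup>2"
      unfolding diff using q_bounds N_ge_2 by (simp add: field_simps)
    finally have "q ^ s - y ^ s \<le> real s * (2 / N\<^sup>2)" by (simp add: mult_left_mono)
    hence "q ^ t * (q ^ s - y ^ s) \<le> q ^ t * (real s * (2 / N\<^sup>2))"
      using q_bounds by (intro mult_left_mono) auto
    moreover have "0 \<le> q ^ t * (q ^ s - y ^ s)"
      using q_bounds y by (intro mult_nonneg_nonneg) (auto simp: power_mono)
    moreover have "(1 - real (card {a, b}) / N) ^ s * q ^ d = q ^ t * y ^ s"
      using False q_bounds by (simp add: t y_def power_divide power_add)
    ultimately show ?thesis unfolding eq using False le.hyps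
      by (simp add: algebra_simps min_def max_def)
  qed
next
  case (sym s t)
  from sym.IH[OF sym.prems(2,1)] show ?case
    by (simp add: mult.commute min.commute max.commute eq_commute[of a b])
qed

text \<open>Never meeting \<open>b\<close> has probability at most \<open>q ^ s\<close> for every
  \<open>s\<close>, hence 0.\<close>

lemma AE_first_occ:
  assumes "b \<in> B"
  shows "AE \<omega> in S. \<forall>s. absent s b \<omega> \<longleftrightarrow> s < first_occ b \<omega>" and "AE \<omega> in S. first_occ b \<omega> \<ge> 1"
proof -
  have prob_absent: "S.prob {\<omega> \<in> space S. absent s b \<omega>} = q ^ s" for s
  proof -
    have "S.prob {\<omega> \<in> space S. absent s b \<omega>} = (\<integral>\<omega>. indicator {\<omega> \<in> space S. absent s b \<omega>} \<omega> \<partial>S)"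
      by simp
    also have "\<dots> = (\<integral>\<omega>. of_bool (absent s b \<omega>) \<partial>S)"
      by (intro Bochner_Integration.integral_cong) (auto simp: indicator_def)
    finally show ?thesis using assms by (simp add: integral_absent_single)
  qed
  have "S.prob {\<omega> \<in> space S. \<not> (\<exists>i. \<omega> !! i = b)} \<le> q ^ s" for s
    unfolding prob_absent[symmetric] by (intro S.finite_measure_mono) (auto simp: absent_def)
  hence "S.prob {\<omega> \<in> space S. \<not> (\<exists>i. \<omega> !! i = b)} \<le> 0"
    using q_bounds by (intro LIMSEQ_le_const[OF LIMSEQ_power_zero[of q]]) auto
  hence "AE \<omega> in S. \<exists>i. \<omega> !! i = b"
    by (subst AE_iff_measurable[OF _ refl]) (auto simp: S.emeasure_eq_measure measure_le_0_iff)
  thus "AE \<omega> in S. \<forall>s. absent s b \<omega> \<longleftrightarrow> s < first_occ b \<omega>" "AE \<omega> in S. first_occ b \<omega> \<ge> 1"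
    by (eventually_elim, metis absent_iff_less_first_occ)+
qed

lemma prob_less_first_occ:
  assumes "b \<in> B"
  shows "S.prob {\<omega> \<in> space S. s < first_occ b \<omega>} = q ^ s"
proof -
  have "S.prob {\<omega> \<in> space S. s < first_occ b \<omega>} = (\<integral>\<omega>. indicator {\<omega> \<in> space S. s < first_occ b \<omega>} \<omega> \<partial>S)"
    by simp
  also have "\<dots> = (\<integral>\<omega>. of_bool (absent s b \<omega>) \<partial>S)"
    using AE_first_occ(1)[OF assms]
    by (intro integral_cong_AE) (auto elim!: eventually_mono simp: indicator_def)
  finally show ?thesis using assms by (simp add: integral_absent_single)
qed

end

text \<open>The intended \<open>f\<close> is \<open>cis (v * (ln t - ln N + \<gamma>))\<close> as a
  function of \<open>t\<close>, with \<open>u = \<bar>v\<bar>\<close>. The variance and peeling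
  arguments rest on just its boundedness and the size of its increments.\<close>

locale uniform_stream_test_function = uniform_stream B for B :: "'a set" +
  fixes f :: "nat \<Rightarrow> complex" and u :: real
  assumes norm_f: "norm (f t) \<le> 1"
    and increment_f: "s \<ge> 1 \<Longrightarrow> norm (f (Suc s) - f s) \<le> u / real s"
begin

text \<open>The mean of \<open>f\<close> at a geometric time, written through the ceiling of a
  scaled exponential so that the comparison with Gamma applies directly.\<close>

definition mean :: complex where
  "mean = (\<integral>x. f (nat \<lceil>x / - ln q\<rceil>) \<partial>density lborel (exponential_density 1))"

text \<open>Conditional expectation of \<open>f\<close> at the return time of a uniform random
  letter, given the stream \<open>\<omega>\<close> that follows it.\<close>

definition cond_mean :: "'a stream \<Rightarrow> complex" where
  "cond_mean \<omega> = (\<Sum>b\<in>B. f (first_occ b \<omega>)) / N"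

definition return_prod :: "nat \<Rightarrow> 'a stream \<Rightarrow> complex" where
  "return_prod k \<omega> = (\<Prod>i<k. f (first_occ (\<omega> !! i) (sdrop (Suc i) \<omega>)))"

lemma u_nonneg: "0 \<le> u"
  using order.trans[OF norm_ge_zero increment_f[of 1]] by simp

lemma truncated_means_LIMSEQ:
  "(\<lambda>n. f 1 + (\<Sum>s=1..n. (f (Suc s) - f s) * q ^ s)) \<longlonglongrightarrow> mean"
  unfolding mean_def using q_bounds norm_f by (intro geometric_sum_LIMSEQ_exponential) auto

text \<open>The first occurrence time and the ceiling in \<open>mean\<close> have the same geometric
  tails, so both means are limits of the same truncated sums.\<close>

lemma integral_f_first_occ:
  assumes "b \<in> B"
  shows "(\<integral>\<omega>. f (first_occ b \<omega>) \<partial>S) = mean"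
proof (rule LIMSEQ_unique[OF _ truncated_means_LIMSEQ])
  show "(\<lambda>n. f 1 + (\<Sum>s=1..n. (f (Suc s) - f s) * q ^ s)) \<longlonglongrightarrow> (\<integral>\<omega>. f (first_occ b \<omega>) \<partial>S)"
    using norm_f AE_first_occ(2)[OF assms] prob_less_first_occ[OF assms]
    by (intro S.geometric_tail_integral_LIMSEQ) auto
qed

lemma norm_mean: "norm mean \<le> 1"
proof -
  obtain b where b: "b \<in> B" using card_B by fastforce
  have "norm (\<integral>\<omega>. f (first_occ b \<omega>) \<partial>S) \<le> (\<integral>\<omega>. 1 \<partial>S)"
    using norm_f by (intro order.trans[OF integral_norm_bound] integral_mono S.integrable_const_bound[of _ 1]) auto
  thus ?thesis using b by (simp add: integral_f_first_occ S.prob_space)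
qed

lemma measurable_cond_mean [measurable]: "cond_mean \<in> borel_measurable S"
  unfolding cond_mean_def[abs_def] by measurable

lemma norm_average_le:
  assumes "\<And>b. b \<in> B \<Longrightarrow> norm (h b :: complex) \<le> 1"
  shows "norm ((\<Sum>b\<in>B. h b) / N) \<le> 1"
proof -
  have "norm (\<Sum>b\<in>B. h b) \<le> N" using sum_norm_le[of B h "\<lambda>_. 1"] assms by simp
  thus ?thesis using N_ge_2 by (simp add: norm_divide)
qed

text \<open>Summation by parts turns \<open>f(T_b)\<close> into a sum of the indicators of \<open>T_b > s\<close> with small
  coefficients, so that only the covariances of these indicators matter.\<close>

lemma truncated_cond_mean_variance:
  "(\<integral>\<omega>. (norm ((\<Sum>b\<in>B. f (min (first_occ b \<omega>) (Suc n))) / N 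
           - (f 1 + (\<Sum>s=1..n. (f (Suc s) - f s) * q ^ s))))\<^sup>2 \<partial>S) \<le> 6 * u\<^sup>2 / N"
proof -
  \<comment> \<open>Off a null set the deviation is a linear combination of the centred indicators
    \<open>\<xi>\<close> with weights \<open>a\<close>, one for each letter and each time up to
    \<open>n\<close>.\<close>
  define \<xi> :: "'a \<times> nat \<Rightarrow> 'a stream \<Rightarrow> real" 
    where "\<xi> = (\<lambda>(b, s) \<omega>. of_bool (absent s b \<omega>) - q ^ s)"
  define a where "a = (\<lambda>(b :: 'a, s). (f (Suc s) - f s) / N)"
  let ?I = "B \<times> {1..n}"
  have "(\<integral>\<omega>. (norm ((\<Sum>b\<in>B. f (min (first_occ b \<omega>) (Suc n))) / N 
           - (f 1 + (\<Sum>s=1..n. (f (Suc s) - f s) * q ^ s))))\<^sup>2 \<partial>S)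
      = (\<integral>\<omega>. (norm (\<Sum>i\<in>?I. a i * \<xi> i \<omega>))\<^sup>2 \<partial>S)"
  proof (intro integral_cong_AE)
    have "AE \<omega> in S. \<forall>b\<in>B. (\<forall>s. absent s b \<omega> \<longleftrightarrow> s < first_occ b \<omega>) \<and> first_occ b \<omega> \<ge> 1"
      using finite_B AE_first_occ by (intro AE_finite_allI) auto
    thus "AE \<omega> in S. (norm ((\<Sum>b\<in>B. f (min (first_occ b \<omega>) (Suc n))) / N 
           - (f 1 + (\<Sum>s=1..n. (f (Suc s) - f s) * q ^ s))))\<^sup>2 = (norm (\<Sum>i\<in>?I. a i * \<xi> i \<omega>))\<^sup>2"
    proof eventually_elim
      case (elim \<omega>)
      let ?C = "f 1 + (\<Sum>s=1..n. (f (Suc s) - f s) * q ^ s)"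
      have "(\<Sum>b\<in>B. f (min (first_occ b \<omega>) (Suc n))) / N - ?C
          = (\<Sum>b\<in>B. f (min (first_occ b \<omega>) (Suc n)) - ?C) / N"
        using N_ge_2 by (simp add: sum_subtractf diff_divide_distrib)
      also have "\<dots> = (\<Sum>b\<in>B. \<Sum>s=1..n. a (b, s) * \<xi> (b, s) \<omega>)"
        unfolding sum_divide_distrib
      proof (rule sum.cong)
        fix b assume b: "b \<in> B"
        have "f (min (first_occ b \<omega>) (Suc n)) - ?C
            = (\<Sum>s=1..n. (f (Suc s) - f s) * of_bool (s < first_occ b \<omega>)) - (\<Sum>s=1..n. (f (Suc s) - f s) * q ^ s)"
          using elim b by (subst sum_increments_min[symmetric]) (auto simp del: sum_mult_of_bool_eq)
        also have "\<dots> = (\<Sum>s=1..n. (f (Suc s) - f s) * \<xi> (b, s) \<omega>)"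
          unfolding sum_subtractf[symmetric] using elim b 
          by (intro sum.cong) (auto simp: \<xi>_def algebra_simps)
        finally show "(f (min (first_occ b \<omega>) (Suc n)) - ?C) / N = (\<Sum>s=1..n. a (b, s) * \<xi> (b, s) \<omega>)"
          by (simp add: a_def sum_divide_distrib)
      qed simp
      also have "\<dots> = (\<Sum>i\<in>?I. a i * \<xi> i \<omega>)"
        by (simp add: sum.cartesian_product case_prod_beta)
      finally show ?case by simp
    qed
  qed (auto simp: \<xi>_def case_prod_beta)
  also have "\<dots> \<le> (\<Sum>i\<in>?I. \<Sum>j\<in>?I. norm (a i) * norm (a j) * \<bar>\<integral>\<omega>. \<xi> i \<omega> * \<xi> j \<omega> \<partial>S\<bar>)"
  proof (rule S.norm_weighted_sum_second_moment_le)
    show "integrable S (\<lambda>\<omega>. \<xi> i \<omega> * \<xi> j \<omega>)" for i j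
    proof (rule S.integrable_const_bound[of _ 1])
      have le: "\<bar>\<xi> i \<omega>\<bar> \<le> 1" for i \<omega>
        using q_bounds power_le_one[of q "snd i"] by (auto simp: \<xi>_def case_prod_beta)
      show "AE \<omega> in S. norm (\<xi> i \<omega> * \<xi> j \<omega>) \<le> 1"
        using mult_le_one[OF le abs_ge_zero le] by (auto simp: abs_mult)
    qed (auto simp: \<xi>_def case_prod_beta)
  qed (use finite_B in auto)
  also have "\<dots> = (\<Sum>b\<in>B. \<Sum>s=1..n. \<Sum>b'\<in>B. \<Sum>t=1..n. norm (a (b, s)) * norm (a (b', t)) * 
       \<bar>\<integral>\<omega>. \<xi> (b, s) \<omega> * \<xi> (b', t) \<omega> \<partial>S\<bar>)"
    by (simp only: sum.cartesian_product')
  also have "\<dots> \<le> (\<Sum>b\<in>B. \<Sum>s=1..n. \<Sum>b'\<in>B. \<Sum>t=1..n. (u / s / N) * (u / t / N) *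
       ((if b = b' then 1 / N else 2 / N\<^sup>2) * (real (min s t) * q ^ max s t)))"
  proof (intro sum_mono mult_mono)
    fix b b' s t assume *: "b \<in> B" "b' \<in> B" "s \<in> {1..n}" "t \<in> {1..n}"
    show "norm (a (b, s)) \<le> u / s / N" "norm (a (b', t)) \<le> u / t / N"
      using * N_ge_2 by (auto simp: a_def norm_divide simp del: divide_divide_eq_left intro!: divide_right_mono increment_f)
    show "\<bar>\<integral>\<omega>. \<xi> (b, s) \<omega> * \<xi> (b', t) \<omega> \<partial>S\<bar>
        \<le> (if b = b' then 1 / N else 2 / N\<^sup>2) * (real (min s t) * q ^ max s t)"
      unfolding \<xi>_def case_prod_conv using * by (intro covariance_absent)
  qed (use u_nonneg in auto)
  also have "\<dots> = (\<Sum>b\<in>B. \<Sum>b'\<in>B. \<Sum>s=1..n. \<Sum>t=1..n. (u / s / N) * (u / t / N) *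
       ((if b = b' then 1 / N else 2 / N\<^sup>2) * (real (min s t) * q ^ max s t)))"
    by (intro sum.cong refl sum.swap)
  also have "\<dots> = (\<Sum>b\<in>B. \<Sum>b'\<in>B. (if b = b' then 1 / N else 2 / N\<^sup>2)) * (u\<^sup>2 / N\<^sup>2) * 
       (\<Sum>s=1..n. \<Sum>t=1..n. 1 / real s * (1 / real t) * (real (min s t) * q ^ max s t))"
    by (simp add: sum_distrib_left sum_distrib_right sum_divide_distrib power2_eq_square mult_ac)
  \<comment> \<open>The 3 comes from \<open>N\<close> diagonal pairs at \<open>1 / N\<close> and
    \<open>N^2\<close> pairs at \<open>2 / N^2\<close>. As \<open>1 - q = 1 / N\<close>, the last
    factor is \<open>2 * N\<close>.\<close>
  also have "\<dots> \<le> 3 * (u\<^sup>2 / N\<^sup>2) * (2 / (1 - q))"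
  proof (intro mult_mono)
    have "(\<Sum>b\<in>B. \<Sum>b'\<in>B. (if b = b' then 1 / N else 2 / N\<^sup>2)) 
        \<le> (\<Sum>b\<in>B. \<Sum>b'\<in>B. (if b = b' then 1 / N else 0) + 2 / N\<^sup>2)"
      by (intro sum_mono) auto
    also have "\<dots> = 3"
      using finite_B N_ge_2 by (auto simp: sum.distrib power2_eq_square)
    finally show "(\<Sum>b\<in>B. \<Sum>b'\<in>B. (if b = b' then 1 / N else 2 / N\<^sup>2)) \<le> 3" .
    show "(\<Sum>s=1..n. \<Sum>t=1..n. 1 / real s * (1 / real t) * (real (min s t) * q ^ max s t)) \<le> 2 / (1 - q)"
      using q_bounds by (intro sum_min_power_max_le) auto
  qed (use q_bounds in \<open>auto intro!: sum_nonneg\<close>)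
  also have "\<dots> = 6 * u\<^sup>2 / N"
    using N_ge_2 by (simp add: power2_eq_square)
  finally show ?thesis .
qed

text \<open>Dominated convergence applies to the truncated estimate: the variables are bounded
  uniformly in \<open>n\<close>, since their centring constants converge.\<close>

lemma cond_mean_variance: "(\<integral>\<omega>. (norm (cond_mean \<omega> - mean))\<^sup>2 \<partial>S) \<le> 6 * u\<^sup>2 / N"
proof (rule LIMSEQ_le_const2)
  let ?C = "\<lambda>n. f 1 + (\<Sum>s=1..n. (f (Suc s) - f s) * q ^ s)"
  let ?G = "\<lambda>n \<omega>. (\<Sum>b\<in>B. f (min (first_occ b \<omega>) (Suc n))) / N"
  obtain K where K: "\<And>n. norm (?C n) \<le> K"
    using convergent_imp_Bseq[OF convergentI[OF truncated_means_LIMSEQ]] by (auto simp: Bseq_def)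
  show "(\<lambda>n. \<integral>\<omega>. (norm (?G n \<omega> - ?C n))\<^sup>2 \<partial>S) \<longlonglongrightarrow> (\<integral>\<omega>. (norm (cond_mean \<omega> - mean))\<^sup>2 \<partial>S)"
  proof (rule integral_dominated_convergence[where w = "\<lambda>_. (1 + K)\<^sup>2"])
    fix n
    have "norm (?G n \<omega> - ?C n) \<le> 1 + K" for \<omega>
      using norm_triangle_ineq4[of "?G n \<omega>" "?C n"] K[of n] norm_f
        norm_average_le[of "\<lambda>b. f (min (first_occ b \<omega>) (Suc n))"] by force
    thus "AE \<omega> in S. norm ((norm (?G n \<omega> - ?C n))\<^sup>2) \<le> (1 + K)\<^sup>2"
      by (auto intro!: power_mono)
  next
    have "(\<lambda>n. ?G n \<omega>) \<longlonglongrightarrow> cond_mean \<omega>" for \<omega>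
      unfolding cond_mean_def
    proof (intro tendsto_divide tendsto_sum tendsto_const)
      fix b
      have "\<forall>\<^sub>F n in sequentially. f (min (first_occ b \<omega>) (Suc n)) = f (first_occ b \<omega>)"
        using eventually_ge_at_top[of "first_occ b \<omega>"] by eventually_elim (simp add: min_def)
      thus "(\<lambda>n. f (min (first_occ b \<omega>) (Suc n))) \<longlonglongrightarrow> f (first_occ b \<omega>)" by (rule tendsto_eventually)
    qed (use N_ge_2 in auto)
    hence "(\<lambda>n. (norm (?G n \<omega> - ?C n))\<^sup>2) \<longlonglongrightarrow> (norm (cond_mean \<omega> - mean))\<^sup>2" for \<omega>
      by (intro tendsto_intros truncated_means_LIMSEQ)
    thus "AE \<omega> in S. (\<lambda>n. (norm (?G n \<omega> - ?C n))\<^sup>2) \<longlonglongrightarrow> (norm (cond_mean \<omega> - mean))\<^sup>2" by simp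
  qed auto
  show "\<exists>n0. \<forall>n\<ge>n0. (\<integral>\<omega>. (norm (?G n \<omega> - ?C n))\<^sup>2 \<partial>S) \<le> 6 * u\<^sup>2 / N"
    using truncated_cond_mean_variance by blast
qed

text \<open>Nonnegativity of the variance bounds the squared first moment by the second; the 6 is
  rounded up to the square of 3.\<close>

lemma cond_mean_deviation: "(\<integral>\<omega>. norm (cond_mean \<omega> - mean) \<partial>S) \<le> 3 * u / sqrt N"
proof -
  have le: "norm (cond_mean \<omega> - mean) \<le> 2" for \<omega>
    using norm_triangle_ineq4[of "cond_mean \<omega>" mean] norm_mean norm_f
      norm_average_le[of "\<lambda>b. f (first_occ b \<omega>)"] unfolding cond_mean_def by force
  have int: "integrable S (\<lambda>\<omega>. norm (cond_mean \<omega> - mean))"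
    using le by (intro S.integrable_const_bound[of _ 2]) auto
  have int2: "integrable S (\<lambda>\<omega>. (norm (cond_mean \<omega> - mean))\<^sup>2)"
    using power_mono[OF le norm_ge_zero, where n = 2] by (intro S.integrable_const_bound[of _ 4]) auto
  have "(\<integral>\<omega>. norm (cond_mean \<omega> - mean) \<partial>S)\<^sup>2 \<le> (\<integral>\<omega>. (norm (cond_mean \<omega> - mean))\<^sup>2 \<partial>S)"
    using S.variance_positive[of "\<lambda>\<omega>. norm (cond_mean \<omega> - mean)"] S.variance_eq[OF int int2] by simp
  also note cond_mean_variance
  also have "6 * u\<^sup>2 / N \<le> (3 * u / sqrt N)\<^sup>2"
    by (simp add: power_divide power_mult_distrib divide_right_mono)
  finally show ?thesis using u_nonneg by (auto intro: power2_le_imp_le)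
qed

section \<open>Peeling off the return times one at a time\<close>

lemma measurable_return_prod [measurable]: "return_prod k \<in> borel_measurable S"
  unfolding return_prod_def[abs_def] by measurable

lemma norm_return_prod: "norm (return_prod k \<omega>) \<le> 1"
  unfolding return_prod_def prod_norm[symmetric] using norm_f by (intro prod_le_1) auto

lemma return_prod_Suc_Stream: "return_prod (Suc k) (x ## \<omega>) = f (first_occ x \<omega>) * return_prod k \<omega>"
  by (simp add: return_prod_def prod.lessThan_Suc_shift del: prod.lessThan_Suc)

text \<open>The first letter is uniform and enters only the first factor, because later return times
  look forward. Averaging that factor over the letter gives \<open>cond_mean\<close>.\<close>

lemma integral_return_prod_Suc:
  "(\<integral>\<omega>. return_prod (Suc k) \<omega> \<partial>S) = (\<integral>\<omega>. cond_mean \<omega> * return_prod k \<omega> \<partial>S)"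
proof -
  have int: "integrable S (\<lambda>\<omega>. f (first_occ x \<omega>) * return_prod k \<omega>)" for x
    using norm_f norm_return_prod
    by (intro S.integrable_const_bound[of _ 1]) (auto simp: norm_mult intro!: mult_le_one)
  have "(\<integral>\<omega>. return_prod (Suc k) \<omega> \<partial>S) 
      = (1 / N) *\<^sub>R (\<Sum>x\<in>B. \<integral>\<omega>. f (first_occ x \<omega>) * return_prod k \<omega> \<partial>S)"
    using norm_return_prod unfolding return_prod_Suc_Stream[symmetric]
    by (intro integral_S S.integrable_const_bound[of _ 1]) auto
  also have "\<dots> = (\<integral>\<omega>. (\<Sum>x\<in>B. f (first_occ x \<omega>) * return_prod k \<omega>) / N \<partial>S)"
    using int by (simp add: Bochner_Integration.integral_sum scaleR_conv_of_real field_simps)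
  finally show ?thesis by (simp add: cond_mean_def sum_distrib_right)
qed

text \<open>Replacing \<open>cond_mean\<close> by \<open>mean\<close> in one factor costs at most
  its L1 deviation, because the remaining product has modulus at most 1; the dependence between the
  two is harmless. The costs add up over \<open>k\<close> steps as \<open>mean\<close> also has
  modulus at most 1.\<close>

lemma integral_return_prod_approx:
  "norm ((\<integral>\<omega>. return_prod k \<omega> \<partial>S) - mean ^ k) \<le> real k * (3 * u / sqrt N)"
proof (induction k)
  case (Suc k)
  let ?R = "\<integral>\<omega>. return_prod k \<omega> \<partial>S"
  have [simp]: "integrable S (return_prod k)"
    using norm_return_prod by (intro S.integrable_const_bound[of _ 1]) auto
  have norm_cond_mean: "norm (cond_mean \<omega>) \<le> 1" for \<omega>
    using norm_average_le[of "\<lambda>b. f (first_occ b \<omega>)"] norm_f unfolding cond_mean_def by force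
  have [simp]: "integrable S (\<lambda>\<omega>. cond_mean \<omega> * return_prod k \<omega>)"
    using norm_return_prod norm_cond_mean
    by (intro S.integrable_const_bound[of _ 1]) (auto simp: norm_mult intro!: mult_le_one)
  have [simp]: "integrable S cond_mean"
    using norm_cond_mean by (intro S.integrable_const_bound[of _ 1]) auto
  have [simp]: "integrable S (\<lambda>\<omega>. (cond_mean \<omega> - mean) * return_prod k \<omega>)"
    by (simp add: left_diff_distrib)
  have "norm ((\<integral>\<omega>. return_prod (Suc k) \<omega> \<partial>S) - mean * ?R)
      = norm (\<integral>\<omega>. (cond_mean \<omega> - mean) * return_prod k \<omega> \<partial>S)"
    by (simp add: integral_return_prod_Suc left_diff_distrib)
  also have "\<dots> \<le> (\<integral>\<omega>. norm (cond_mean \<omega> - mean) \<partial>S)"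
    using norm_return_prod
    by (intro order.trans[OF integral_norm_bound] integral_mono integrable_norm) (auto simp: norm_mult intro!: mult_left_le)
  also note cond_mean_deviation
  finally have "norm ((\<integral>\<omega>. return_prod (Suc k) \<omega> \<partial>S) - mean * ?R) \<le> 3 * u / sqrt N" .
  moreover have "norm (mean * ?R - mean ^ Suc k) \<le> real k * (3 * u / sqrt N)"
  proof -
    have "norm (mean * ?R - mean ^ Suc k) = norm mean * norm (?R - mean ^ k)"
      by (simp add: norm_mult[symmetric] right_diff_distrib)
    also have "\<dots> \<le> norm (?R - mean ^ k)" using norm_mean by (intro mult_left_le_one_le) auto
    finally show ?thesis using Suc by simp
  qed
  ultimately show ?case
    using norm_triangle_ineq[of "(\<integral>\<omega>. return_prod (Suc k) \<omega> \<partial>S) - mean * ?R" "mean * ?R - mean ^ Suc k"]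
    by (simp add: distrib_right add_divide_distrib algebra_simps)
qed (simp add: return_prod_def S.prob_space)

end

subsection \<open>Blocks of the process\<close>

context uniform_stream
begin

text \<open>The constant is 3 from peeling plus 8 from replacing the geometric mean by its Gamma
  value.\<close>

lemma expectation_return_prod_cis_ln:
  fixes u :: real
  shows "norm ((\<integral>\<omega>. (\<Prod>i<k. cis (u * (ln (real (first_occ (\<omega> !! i) (sdrop (Suc i) \<omega>))) - ln N + euler_mascheroni))) \<partial>S)
       - (cis (u * euler_mascheroni) * Gamma (1 + \<i> * u)) ^ k) \<le> 11 * real k * \<bar>u\<bar> / sqrt N"
proof -
  define f where "f = (\<lambda>t::nat. cis (u * (ln (real t) - ln N + euler_mascheroni)))"
  let ?\<phi> = "cis (u * euler_mascheroni) * Gamma (1 + \<i> * u)"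
  interpret uniform_stream_test_function B f "\<bar>u\<bar>"
  proof
    fix s :: nat assume s: "s \<ge> 1"
    have "norm (f (Suc s) - f s) \<le> \<bar>u * (ln (real (Suc s)) - ln N + euler_mascheroni)
        - u * (ln (real s) - ln N + euler_mascheroni)\<bar>"
      unfolding f_def by (rule norm_cis_diff_le)
    also have "\<dots> = \<bar>u\<bar> * (ln (real (Suc s)) - ln (real s))"
      using s by (simp add: right_diff_distrib[symmetric] abs_mult)
    also have "ln (real (Suc s)) - ln (real s) = ln (1 + 1 / real s)"
      using s ln_div[of "real (Suc s)" "real s"] by (simp add: add_divide_distrib add.commute)
    also have "\<dots> \<le> 1 / real s" by (rule ln_add_one_self_le_self) simp
    finally show "norm (f (Suc s) - f s) \<le> \<bar>u\<bar> / real s" by (simp add: mult_left_mono)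
  qed (simp add: f_def)
  have mean: "norm (mean - ?\<phi>) \<le> 8 * \<bar>u\<bar> / sqrt N"
    unfolding mean_def unfolding f_def using N_ge_2 by (rule expectation_cis_ln_ceiling_exponential)
  interpret E: prob_space "density lborel (exponential_density 1)"
    by (rule prob_space_exponential_density) simp
  \<comment> \<open>As the mean of a unimodular function, this value lies in the unit disc, as does
    \<open>mean\<close>. Hence the \<open>k\<close>-th powers differ by at most \<open>k\<close>
    times the difference of the bases.\<close>
  have "norm ?\<phi> \<le> 1"
    unfolding integral_exponential_cis_ln[symmetric]
    using integral_norm_bound[of "density lborel (exponential_density 1)" 
       "\<lambda>x. cis (u * (ln x + euler_mascheroni))"] E.prob_space by simp
  hence "norm (mean ^ k - ?\<phi> ^ k) \<le> real k * norm (mean - ?\<phi>)"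
    using norm_mean by (intro norm_power_diff)
  also have "\<dots> \<le> real k * (8 * \<bar>u\<bar> / sqrt N)"
    using mean by (intro mult_left_mono) auto
  finally have "norm (mean ^ k - ?\<phi> ^ k) \<le> real k * (8 * \<bar>u\<bar> / sqrt N)" .
  moreover note integral_return_prod_approx[of k]
  ultimately have "norm ((\<integral>\<omega>. return_prod k \<omega> \<partial>S) - ?\<phi> ^ k) 
      \<le> real k * (3 * \<bar>u\<bar> / sqrt N) + real k * (8 * \<bar>u\<bar> / sqrt N)"
    by (rule norm_diff_triangle_le[rotated])
  hence "norm ((\<integral>\<omega>. return_prod k \<omega> \<partial>S) - ?\<phi> ^ k) \<le> 11 * real k * \<bar>u\<bar> / sqrt N"
    by (simp add: add_divide_distrib[symmetric] algebra_simps)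
  thus ?thesis unfolding return_prod_def unfolding f_def .
qed

end

text \<open>Independence makes the joint law a product measure on sequences, and
  \<open>stream_space\<close> is the image of that measure under \<open>to_stream\<close>.\<close>

lemma (in prob_space) distr_iid_to_stream:
  assumes ind: "indep_vars (\<lambda>_. N) X (UNIV :: nat set)"
    and dist: "\<And>i. distr M N (X i) = U" 
  shows "distr M (stream_space U) (\<lambda>w. to_stream (\<lambda>i. X i w)) = stream_space U"
proof -
  have sets_eq: "sets N = sets U" using dist[of 0] by (metis sets_distr)
  have X [measurable]: "X i \<in> measurable M U" for i
    using ind by (simp add: indep_vars_def measurable_cong_sets[OF refl sets_eq])
  have "distr M (\<Pi>\<^sub>M i\<in>UNIV. U) (\<lambda>w i. X i w) = distr M (\<Pi>\<^sub>M i\<in>UNIV. N) (\<lambda>w i. X i w)"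
    by (intro distr_cong refl sets_PiM_cong) (simp add: sets_eq)
  also have "\<dots> = (\<Pi>\<^sub>M i\<in>UNIV. U)"
    using indep_vars_iff_distr_eq_PiM[where I = UNIV and M' = "\<lambda>_. N" and X = X] ind dist by (simp add: restrict_UNIV indep_vars_def)
  finally have *: "distr M (\<Pi>\<^sub>M i\<in>UNIV. U) (\<lambda>w i. X i w) = (\<Pi>\<^sub>M i\<in>UNIV. U)" .
  have "stream_space U = distr (\<Pi>\<^sub>M i\<in>UNIV. U) (stream_space U) to_stream"
    by (rule stream_space_eq_distr)
  also have "\<dots> = distr M (stream_space U) (to_stream \<circ> (\<lambda>w i. X i w))"
    by (subst *[symmetric], subst distr_distr) (auto intro!: measurable_PiM_single' measurable_space[OF X])
  finally show ?thesis by (simp add: comp_def)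
qed

section \<open>Uniform blocks, entropy rate and return times of the process\<close>

locale uniform_process = prob_space M for M :: "'w measure" +
  fixes A :: "'a set" and Z :: "nat \<Rightarrow> 'w \<Rightarrow> 'a"
  assumes finite_A: "finite A" and iid: "iid_uniform_process M A Z"
begin

definition blocks :: "nat \<Rightarrow> 'a list set" where
  "blocks l = {xs. set xs \<subseteq> A \<and> length xs = l}"

lemma finite_blocks: "finite (blocks l)" and card_blocks: "card (blocks l) = card A ^ l"
  unfolding blocks_def using finite_A by (auto intro: finite_lists_length_eq card_lists_length_eq)

lemma measurable_Z: "i \<ge> 1 \<Longrightarrow> Z i \<in> measurable M (count_space A)"
  and indep_Z: "indep_vars (\<lambda>_. count_space A) Z {1..}"
  using iid by (auto simp: iid_uniform_process_def indep_vars_def)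

lemma prob_Z_eq:
  assumes "i \<ge> 1" "a \<in> A"
  shows "prob (Z i -` {a} \<inter> space M) = 1 / card A"
proof -
  have "prob (Z i -` {a} \<inter> space M) = measure (distr M (count_space A) (Z i)) {a}"
    using assms measurable_Z by (subst measure_distr) auto
  also have "\<dots> = measure (uniform_count_measure A) {a}"
    using iid assms by (simp add: iid_uniform_process_def)
  finally show ?thesis using assms finite_A by (simp add: measure_uniform_count_measure)
qed

lemma measurable_map_blocks:
  assumes "length js = l"
  shows "(\<lambda>g. map g js) \<in> measurable (PiM (set js) (\<lambda>_. count_space A)) (count_space (blocks l))"
proof (subst measurable_count_space_eq2[OF finite_blocks], intro conjI ballI Pi_I)
  let ?P = "PiM (set js) (\<lambda>_. count_space A)"
  show "map g js \<in> blocks l" if "g \<in> space ?P" for g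
    using that assms by (auto simp: blocks_def space_PiM PiE_iff)
  fix b assume "b \<in> blocks l"
  have comp: "Measurable.pred ?P (\<lambda>g. g (js ! i) = b ! i)" if "i < l" for i
  proof -
    have "(\<lambda>g. g (js ! i)) \<in> measurable ?P (count_space A)"
      using that assms by (intro measurable_component_singleton) auto
    moreover have "(\<lambda>a. a = b ! i) \<in> measurable (count_space A) (count_space UNIV)" by simp
    ultimately show ?thesis by (rule measurable_compose)
  qed
  have "(\<lambda>g. map g js) -` {b} \<inter> space ?P = {g \<in> space ?P. \<forall>i<l. g (js ! i) = b ! i}"
    using assms \<open>b \<in> blocks l\<close> by (auto simp: blocks_def list_eq_iff_nth_eq)
  also have "\<dots> \<in> sets ?P"
    using comp by measurable
  finally show "(\<lambda>g. map g js) -` {b} \<inter> space ?P \<in> sets ?P" .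
qed

text \<open>Blocks read disjoint windows of indices. The shift \<open>Suc i\<close> matches blocks
  numbered from 1 with stream positions numbered from 0.\<close>

lemma indep_blocks: "indep_vars (\<lambda>_. count_space (blocks l)) (\<lambda>i. block Z l (Suc i)) UNIV"
proof -
  let ?K = "\<lambda>i. {i * l + 1..<Suc i * l + 1}"
  have disj: "disjoint_family_on ?K UNIV"
  proof (unfold disjoint_family_on_def, intro ballI impI)
    fix i j :: nat assume "i \<noteq> j"
    then consider "Suc i \<le> j" | "Suc j \<le> i" by linarith
    thus "?K i \<inter> ?K j = {}"
      by cases (use mult_le_mono1[of "Suc i" j l] mult_le_mono1[of "Suc j" i l] in auto)
  qed
  have "indep_vars (\<lambda>i. PiM (?K i) (\<lambda>_. count_space A)) (\<lambda>i w. restrict (\<lambda>m. Z m w) (?K i)) UNIV"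
    by (rule indep_vars_restrict[OF indep_Z _ disj]) auto
  hence "indep_vars (\<lambda>_. count_space (blocks l)) 
     (\<lambda>i w. (\<lambda>g. map g [i * l + 1..<Suc i * l + 1]) (restrict (\<lambda>m. Z m w) (?K i))) UNIV"
  proof (rule indep_vars_compose2)
    fix i
    show "(\<lambda>g. map g [i * l + 1..<Suc i * l + 1]) \<in> measurable (PiM (?K i) (\<lambda>_. count_space A)) (count_space (blocks l))"
      using measurable_map_blocks[of "[i * l + 1..<Suc i * l + 1]" l] by (simp del: upt_Suc)
  qed
  also have "(\<lambda>i w. (\<lambda>g. map g [i * l + 1..<Suc i * l + 1]) (restrict (\<lambda>m. Z m w) (?K i))) 
      = (\<lambda>i. block Z l (Suc i))"
    by (auto simp: block_def fun_eq_iff)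
  finally show ?thesis .
qed

lemma measurable_block: "block Z l (Suc i) \<in> measurable M (count_space (blocks l))"
  using indep_blocks[of l] by (auto simp: indep_vars_def)

lemma prob_block_eq:
  assumes l: "l \<ge> 1" and b: "b \<in> blocks l"
  shows "prob (block Z l (Suc i) -` {b} \<inter> space M) = 1 / card A ^ l"
proof -
  let ?K = "{i * l + 1..<Suc i * l + 1}"
  have len: "length b = l" "set b \<subseteq> A" using b by (auto simp: blocks_def)
  \<comment> \<open>Since \<open>l \<ge> 1\<close> the window is nonempty; an empty intersection
    would be the whole type instead of \<open>space M\<close>.\<close>
  have "block Z l (Suc i) -` {b} \<inter> space M = (\<Inter>j\<in>?K. Z j -` {b ! (j - (i * l + 1))} \<inter> space M)"
  proof -
    have "block Z l (Suc i) w = b \<longleftrightarrow> (\<forall>j\<in>?K. Z j w = b ! (j - (i * l + 1)))" for w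
    proof
      assume "block Z l (Suc i) w = b"
      thus "\<forall>j\<in>?K. Z j w = b ! (j - (i * l + 1))" by (auto simp: block_def simp del: upt_Suc)
    next
      assume *: "\<forall>j\<in>?K. Z j w = b ! (j - (i * l + 1))"
      show "block Z l (Suc i) w = b"
        using len by (intro nth_equalityI) (auto simp: block_def * simp del: upt_Suc)
    qed
    thus ?thesis using l by auto
  qed
  also have "prob \<dots> = (\<Prod>j\<in>?K. prob (Z j -` {b ! (j - (i * l + 1))} \<inter> space M))"
    using l len by (intro indep_varsD[OF indep_Z]) (auto intro!: subsetD[OF len(2)] nth_mem)
  also have "\<dots> = (\<Prod>j\<in>?K. 1 / card A)"
    using len by (intro prod.cong prob_Z_eq subsetD[OF len(2)] nth_mem) auto
  finally show ?thesis by (simp add: power_divide)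
qed

lemma distr_block:
  assumes "l \<ge> 1"
  shows "distr M (count_space (blocks l)) (block Z l (Suc i)) = uniform_count_measure (blocks l)"
proof (rule measure_eqI_finite[OF _ _ finite_blocks])
  fix b assume b: "b \<in> blocks l"
  have "emeasure (distr M (count_space (blocks l)) (block Z l (Suc i))) {b} = ennreal (1 / card A ^ l)"
    using b measurable_block prob_block_eq[OF assms b] 
    by (subst emeasure_distr) (auto simp: emeasure_eq_measure)
  thus "emeasure (distr M (count_space (blocks l)) (block Z l (Suc i))) {b} 
      = emeasure (uniform_count_measure (blocks l)) {b}"
    using b finite_blocks by (simp add: emeasure_uniform_count_measure card_blocks)
qed (auto simp: sets_uniform_count_measure)

lemma card_A_pos: "card A > 0"
proof -
  obtain w where "w \<in> space M" using not_empty by auto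
  hence "Z 1 w \<in> A" using measurable_space[OF measurable_Z[of 1]] by auto
  thus ?thesis using finite_A card_gt_0_iff by blast
qed

text \<open>The first block of length \<open>n\<close> is uniform on \<open>card A ^ n\<close>
  words, so the quotient is constant from \<open>n = 1\<close> on.\<close>

lemma process_entropy_eq: "process_entropy M Z = log 2 (card A)"
proof -
  interpret information_space M 2 by unfold_locales simp
  have "entropy 2 (count_space (block Z n 1 ` space M)) (block Z n 1) / real n = log 2 (card A)" if n: "n \<ge> 1" for n
  proof -
    let ?X = "block Z n 1"
    have X: "?X \<in> measurable M (count_space (blocks n))" using measurable_block[of n 0] by simp
    \<comment> \<open>Every word has positive probability and is therefore attained, so the entropy
      is taken over the full set of words.\<close>
    have im: "?X ` space M = blocks n"
    proof (intro equalityI subsetI)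
      fix b assume b: "b \<in> blocks n"
      have "prob (?X -` {b} \<inter> space M) > 0"
        using prob_block_eq[OF n b, of 0] card_A_pos by simp
      hence "?X -` {b} \<inter> space M \<noteq> {}" by force
      thus "b \<in> ?X ` space M" by auto
    qed (use measurable_space[OF X] in auto)
    have "simple_distributed M ?X (\<lambda>_. 1 / card A ^ n)"
    proof (rule simple_distributedI)
      show "simple_function M ?X"
        unfolding simple_function_def im using finite_blocks X by (auto intro: measurable_sets)
    qed (use prob_block_eq[OF n, of _ 0] im in auto)
    from entropy_simple_distributed[OF this]
    have "entropy 2 (count_space (?X ` space M)) ?X = - log 2 (1 / card A ^ n)"
      unfolding im using card_A_pos by (simp add: card_blocks)
    also have "\<dots> = n * log 2 (card A)" 
      using card_A_pos by (simp add: log_divide log_nat_power)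
    finally show ?thesis using n by simp
  qed
  hence "(\<lambda>n. entropy 2 (count_space (block Z n 1 ` space M)) (block Z n 1) / real n) \<longlonglongrightarrow> log 2 (card A)"
    by (intro tendsto_eventually) (auto simp: eventually_at_top_linorder intro!: exI[of _ 1])
  thus ?thesis unfolding process_entropy_def by (rule limI)
qed

text \<open>Index bookkeeping: position \<open>t - 1\<close> after dropping \<open>Suc i\<close>
  entries is position \<open>i + t\<close>, which holds block \<open>Suc i + t\<close>. The two sets
  of times coincide, even when empty.\<close>

lemma return_time_conv_first_occ:
  "return_time Z l (Suc i) w = first_occ (to_stream (\<lambda>j. block Z l (Suc j) w) !! i)
      (sdrop (Suc i) (to_stream (\<lambda>j. block Z l (Suc j) w)))"
  unfolding return_time_def first_occ_def
  by (rule arg_cong[where f = Inf]) (auto simp: sdrop_snth to_stream_def add.commute simp del: sdrop.simps)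

lemma measurable_return_time:
  "return_time Z l (Suc i) \<in> measurable M (count_space UNIV)"
proof -
  have pred: "Measurable.pred M (\<lambda>w. block Z l (Suc i) w = block Z l (Suc j) w)" for i j
  proof -
    have *: "Measurable.pred M (\<lambda>w. block Z l (Suc i) w = b)" for i b
      by (rule measurable_compose[OF measurable_block]) simp
    have "Measurable.pred M (\<lambda>w. \<exists>b\<in>blocks l. block Z l (Suc i) w = b \<and> block Z l (Suc j) w = b)"
      using finite_blocks * by measurable
    also have "?this \<longleftrightarrow> ?thesis"
      using measurable_space[OF measurable_block] by (intro measurable_cong) auto
    finally show ?thesis .
  qed
  have "Measurable.pred M (\<lambda>w. 1 \<le> t \<and> block Z l (Suc i + t) w = block Z l (Suc i) w)" for t
    using pred[of "i + t" i] by simp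
  thus ?thesis unfolding return_time_def[abs_def] by (intro measurable_Inf_Collect_nat)
qed

end

section \<open>Convergence of the characteristic functions of the normalised sums\<close>

theorem proposition3p5:
  fixes M :: "'w measure" and A :: "'a set" and Z :: "nat \<Rightarrow> 'w \<Rightarrow> 'a"
    and k :: "nat \<Rightarrow> nat" and H :: real
  assumes "prob_space M"
    and "finite A"
    and "iid_uniform_process M A Z"
    and "H = process_entropy M Z"
    and "filterlim k at_top sequentially"
    and "(\<lambda>l. real (k l) * real l / real (card A) ^ l) \<longlonglongrightarrow> 0"
  shows "weak_conv_m
    (\<lambda>l. distr M borel (\<lambda>w.
       (\<Sum>i=1..k l. ln (real (return_time Z l i w)) - real l * H * ln 2 + euler_mascheroni)
         / sqrt (real (k l) * pi\<^sup>2 / 6)))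
    std_normal_distribution"
proof -
  interpret prob_space M by fact
  interpret uniform_process M A Z using assms(2,3) by unfold_locales
  define N where "N = (\<lambda>l. real (card A) ^ l)"
  define W where "W = (\<lambda>l w. (\<Sum>i=1..k l. ln (real (return_time Z l i w)) - real l * H * ln 2 + euler_mascheroni)
         / sqrt (real (k l) * pi\<^sup>2 / 6))"
  have k_ge_1: "\<forall>\<^sub>F l in sequentially. k l \<ge> 1"
    using assms(5) by (simp add: filterlim_at_top)
  \<comment> \<open>A one-letter alphabet would turn the growth hypothesis into
    \<open>k l * l\<close> tending to 0, which is impossible as \<open>k l \<ge> 1\<close>
    eventually.\<close>
  have card_A: "card A \<ge> 2"
  proof (rule ccontr)
    assume "\<not> card A \<ge> 2"
    hence "card A = 1" using card_A_pos by linarith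
    hence "(\<lambda>l. real (k l) * real l) \<longlonglongrightarrow> 0" using assms(6) by simp
    hence "\<forall>\<^sub>F l in sequentially. real (k l) * real l < 1" by (rule order_tendstoD) simp
    hence "\<forall>\<^sub>F l :: nat in sequentially. False"
      using k_ge_1 eventually_ge_at_top[of 1]
    proof eventually_elim
      case (elim l)
      hence "1 * 1 \<le> real (k l) * real l" by (intro mult_mono) auto
      thus False using elim by simp
    qed
    thus False by simp
  qed
  have N_pos: "N l > 0" for l using card_A by (simp add: N_def)
  have ln_N: "real l * H * ln 2 = ln (N l)" for l
    using card_A by (simp add: N_def assms(4) process_entropy_eq log_def ln_realpow)
  have return_time_measurable [measurable]: "return_time Z l i \<in> measurable M (count_space UNIV)" if "i \<ge> 1" for l i
    using measurable_return_time[of l "i - 1"] that by simp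
  have W_measurable [measurable]: "W l \<in> borel_measurable M" for l
    unfolding W_def by measurable
  have "weak_conv_m (\<lambda>l. distr M borel (W l)) std_normal_distribution"
  proof (rule levy_continuity)
    show "real_distribution (distr M borel (W l))" for l
      by (rule real_distribution_distr) simp
    show "real_distribution std_normal_distribution" by (rule real_dist_normal_dist)
    fix \<theta> :: real
    define u where "u = (\<lambda>l. \<theta> / sqrt (real (k l) * pi\<^sup>2 / 6))"
    define \<phi> where "\<phi> = (\<lambda>l. cis (u l * euler_mascheroni) * Gamma (1 + \<i> * u l))"
    have bound: "norm (char (distr M borel (W l)) \<theta> - \<phi> l ^ k l) \<le> 11 * real (k l) * \<bar>u l\<bar> / sqrt (N l)"
      if l: "l \<ge> 1" for l
    proof -
      interpret uniform_stream "blocks l"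
      proof
        have "2 ^ 1 \<le> card A ^ 1" using card_A by simp
        also have "\<dots> \<le> card A ^ l" using card_A l by (intro power_increasing) auto
        finally show "2 \<le> card (blocks l)" by (simp add: card_blocks)
      qed (rule finite_blocks)
      let ?st = "\<lambda>w. to_stream (\<lambda>i. block Z l (Suc i) w)"
      let ?S = "stream_space (uniform_count_measure (blocks l))"
      let ?F = "\<lambda>\<omega>. \<Prod>i<k l. cis (u l * (ln (real (first_occ (\<omega> !! i) (sdrop (Suc i) \<omega>))) - ln (real (card (blocks l))) + euler_mascheroni))"
      have st [measurable]: "?st \<in> measurable M ?S"
        by (rule measurable_stream_space2) 
          (use measurable_block in \<open>simp add: to_stream_def measurable_cong_sets[OF refl sets_uniform_count_measure_count_space]\<close>)
      have [measurable]: "cis \<in> borel_measurable borel"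
        by (intro borel_measurable_continuous_onI continuous_intros)
      \<comment> \<open>The exponential of the sum factors over blocks into the product studied on
        streams, with \<open>u l\<close> absorbing \<open>\<theta>\<close> and the
        normalisation.\<close>
      have iexp: "iexp (\<theta> * W l w) = ?F (?st w)" for w
      proof -
        have "\<theta> * W l w = u l * (\<Sum>i=1..k l. ln (real (return_time Z l i w)) - real l * H * ln 2 + euler_mascheroni)"
          by (simp add: W_def u_def)
        also have "\<dots> = (\<Sum>i<k l. u l * (ln (real (return_time Z l (Suc i) w)) - ln (N l) + euler_mascheroni))"
          unfolding ln_N sum_distrib_left
          using sum.shift_bounds_Suc_ivl[of "\<lambda>i. u l * (ln (real (return_time Z l i w)) - ln (N l) + euler_mascheroni)" 0 "k l"]
          by (simp add: atLeastLessThanSuc_atLeastAtMost lessThan_atLeast0)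
        finally have "iexp (\<theta> * W l w) 
            = cis (\<Sum>i<k l. u l * (ln (real (return_time Z l (Suc i) w)) - ln (N l) + euler_mascheroni))"
          by (simp add: cis_conv_exp)
        also have "\<dots> = (\<Prod>i<k l. cis (u l * (ln (real (return_time Z l (Suc i) w)) - ln (N l) + euler_mascheroni)))"
          by (simp add: cis_conv_exp sum_distrib_left exp_sum)
        finally show ?thesis
          by (simp only: return_time_conv_first_occ card_blocks N_def of_nat_power)
      qed
      have "char (distr M borel (W l)) \<theta> = (\<integral>w. iexp (\<theta> * W l w) \<partial>M)"
        unfolding char_def by (subst integral_distr) auto
      also have "\<dots> = (\<integral>w. ?F (?st w) \<partial>M)" unfolding iexp ..
      also have "\<dots> = (\<integral>\<omega>. ?F \<omega> \<partial>distr M ?S ?st)"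
        by (subst integral_distr) (auto simp del: sdrop.simps)
      also have "distr M ?S ?st = ?S"
        using indep_blocks distr_block[OF l] by (rule distr_iid_to_stream)
      finally show ?thesis
        using expectation_return_prod_cis_ln[where k = "k l" and u = "u l"] by (simp add: \<phi>_def N_def card_blocks)
    qed
    have "(\<lambda>l. char (distr M borel (W l)) \<theta> - \<phi> l ^ k l) \<longlonglongrightarrow> 0"
    proof (rule Lim_null_comparison)
      \<comment> \<open>With \<open>u\<close> of order \<open>k^(-1/2)\<close>, the error
        \<open>k * \<bar>u\<bar> / sqrt N\<close> is of order \<open>sqrt (k / N)\<close>. For
        \<open>l \<ge> 1\<close> the quantity \<open>k * l / N\<close> of the hypothesis dominates
        \<open>k / N\<close>.\<close>
      let ?C = "11 * \<bar>\<theta>\<bar> / sqrt (pi\<^sup>2 / 6)"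
      show "\<forall>\<^sub>F l in sequentially. norm (char (distr M borel (W l)) \<theta> - \<phi> l ^ k l)
          \<le> ?C * sqrt (real (k l) * real l / real (card A) ^ l)"
        using k_ge_1 eventually_ge_at_top[of 1]
      proof eventually_elim
        case (elim l)
        have "\<bar>u l\<bar> = \<bar>\<theta>\<bar> / (sqrt (pi\<^sup>2 / 6) * sqrt (real (k l)))"
          unfolding u_def abs_divide real_sqrt_mult[symmetric] by (simp add: mult.commute)
        hence "real (k l) * \<bar>u l\<bar> = \<bar>\<theta>\<bar> / sqrt (pi\<^sup>2 / 6) * (real (k l) / sqrt (real (k l)))"
          by (simp only: times_divide_eq_right divide_divide_eq_left mult.commute)
        also have "real (k l) / sqrt (real (k l)) = sqrt (real (k l))" by (rule real_div_sqrt) simp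
        finally have ku: "real (k l) * \<bar>u l\<bar> = \<bar>\<theta>\<bar> / sqrt (pi\<^sup>2 / 6) * sqrt (real (k l))" .
        have "11 * real (k l) * \<bar>u l\<bar> / sqrt (N l) = ?C * sqrt (real (k l) * 1 / N l)"
          by (simp add: mult.assoc ku real_sqrt_divide)
        also have "\<dots> \<le> ?C * sqrt (real (k l) * real l / N l)"
          using elim N_pos[of l] by (intro mult_left_mono real_sqrt_le_mono divide_right_mono) auto
        finally show ?case using bound[OF elim(2)] by (simp add: N_def)
      qed
      show "(\<lambda>l. ?C * sqrt (real (k l) * real l / real (card A) ^ l)) \<longlonglongrightarrow> 0"
        using tendsto_mult[OF tendsto_const[of ?C] tendsto_real_sqrt[OF assms(6)]] by simp
    qed
    moreover have "(\<lambda>l. \<phi> l ^ k l) \<longlonglongrightarrow> complex_of_real (exp (- (\<theta>\<^sup>2) / 2))"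
      unfolding \<phi>_def u_def using assms(5) by (rule Gamma_power_tendsto_gaussian)
    ultimately show "(\<lambda>l. char (distr M borel (W l)) \<theta>) \<longlonglongrightarrow> char std_normal_distribution \<theta>"
      unfolding char_std_normal_distribution by (rule Lim_transform[rotated])
  qed
  thus ?thesis unfolding W_def .
qed

end
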